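(* Let $A\in A_{\mathrm{inf}}$ be an element such that $$[T^{\flat}] + [(1-T)^{\flat}] - 1 = A\,([p^{\flat}]-p).$$ Then the equality $$\mathrm{d}_{\theta}[T^{\flat}] + \mathrm{d}_{\theta}[(1-T)^{\flat}]= \theta(A)\, \mathrm{d}_{\theta}[p^{\flat}]$$ holds in the $\mathcal{O}_K$-module $\mathbb{T}$.
   Context: $p$ is a fixed prime. $K_0$ is the completion of $\mathbb{Q}_p(T)$ for the discrete valuation with valuation ring $\mathbb{Z}_p[T]_{(p)}$; $\bar K_0$ is an algebraic closure of $K_0$ with the extended valuation; $K$ is the completion of $\bar K_0$; $\mathcal{O}_{K_0},\mathcal{O}_{\bar K_0},\mathcal{O}_K$ are the valuation rings. For $X\in\{p,T,1-T\}$ fix a compatible system of $p$-power roots $X^{1/p^n}\in\mathcal{O}_{\bar K_0}$, $(X^{1/p^n})^p=X^{1/p^{n-1}}$. $\mathcal{O}_{K^\flat}:=\varprojlim_{x\mapsto x^p}\mathcal{O}_K/p$, and $X^\flat:=(X,X^{1/p},X^{1/p^2},\dots)\in\mathcal{O}_{K^\flat}$ (reductions mod $p$). For $n\ge 0$ the multiplicative map $(\ )^{\sharp_n}:\mathcal{O}_{K^\flat}\to\mathcal{O}_K$ is $(\bar x_0,\bar x_1,\dots)\mapsto\lim_{k\ge n}x_k^{p^{k-n}}$, where $x_k\in\mathcal{O}_K$ is any lift of $\bar x_k$. $A_{\mathrm{inf}}:=W(\mathcal{O}_{K^\flat})$ is the ring of $p$-typical Witt vectors, $[a]=(a,0,0,\dots)$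 is the Teichmüller representative, and Fontaine's map $\theta:A_{\mathrm{inf}}\to\mathcal{O}_K$ is the ring homomorphism $(x_0,x_1,\dots)\mapsto\sum_{n\ge 0}p^n x_n^{\sharp_n}$; its kernel is generated by $[p^\flat]-p$. $\mathbb{T}:=\varprojlim_{x\mapsto px}\Omega_{\mathcal{O}_{\bar K_0}/\mathcal{O}_{K_0}}[p^n]$, the inverse limit over $n$ of the $p^n$-torsion submodules of the Kähler differentials with transition maps multiplication by $p$; it is a module over $\mathcal{O}_K=\varprojlim \mathcal{O}_{\bar K_0}/p^n$. For $X\in\{p,T,1-T\}$, $\mathrm{d}_\theta[X^\flat]:=(X^{1-1/p^n}\,\mathrm{d}X^{1/p^n})_{n\in\mathbb{N}}\in\mathbb{T}$. *)

theory Defs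
  imports
    "HOL-Analysis.Elementary_Metric_Spaces"
    "HOL-Computational_Algebra.Polynomial"
    "HOL-Computational_Algebra.Primes"
    "HOL-Library.Poly_Mapping"
    "HOL-Algebra.QuotRing"
    "HOL-Algebra.Module"
    "HOL-Algebra.Algebraic_Closure"
begin

section \<open>The fields and their valuation rings\<close>

text \<open>
  The complete field \<open>K\<close> is a type \<open>'k\<close> of sort field and complete metric space, with absolute
  value \<open>\<bar>x\<bar> = dist x 0\<close>; all other fields are subsets of it. The sort does not relate the metric
  to the field operations; this is done in the locale \<open>gauss_tower\<close> below.
\<close>

definition absval :: "'k::{field_char_0, complete_space} \<Rightarrow> real"
  where "absval x = dist x 0"

definition sub_ring :: "'k::field set \<Rightarrow> 'k ring"
  where "sub_ring S = \<lparr>carrier = S, monoid.mult = (*), one = 1, ring.zero = 0, add = (+)\<rparr>"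

definition val_ring :: "'k::{field_char_0, complete_space} set \<Rightarrow> 'k ring"
  where "val_ring S = sub_ring {x \<in> S. absval x \<le> 1}"

abbreviation OK :: "'k::{field_char_0, complete_space} ring"
  where "OK \<equiv> val_ring UNIV"

definition polys_over :: "'k::zero set \<Rightarrow> 'k Polynomial.poly set"
  where "polys_over S = {f. \<forall>i. Polynomial.coeff f i \<in> S}"

text \<open>
  In a complete field, the completion of a subfield is its closure. In particular \<open>\<rat>\<^sub>p\<close> is the
  closure of \<open>\<rat>\<close>, as the absolute value will be \<open>p\<close>-adic there.
\<close>

definition Qp :: "'k::{field_char_0, complete_space} set"
  where "Qp = closure \<rat>"

definition Zp :: "'k::{field_char_0, complete_space} set"
  where "Zp = {x \<in> Qp. absval x \<le> 1}"

definition QpT :: "'k::{field_char_0, complete_space} \<Rightarrow> 'k set"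
  where "QpT T = {Polynomial.poly f T / Polynomial.poly g T | f g.
     f \<in> polys_over Qp \<and> g \<in> polys_over Qp \<and> Polynomial.poly g T \<noteq> 0}"

definition ZpT_loc :: "nat \<Rightarrow> 'k::{field_char_0, complete_space} \<Rightarrow> 'k set"
  where "ZpT_loc p T = {Polynomial.poly f T / Polynomial.poly g T | f g.
     f \<in> polys_over Zp \<and> g \<in> polys_over Zp \<and> g \<notin> polys_over ((*) (of_nat p) ` Zp)}"

definition K0 :: "'k::{field_char_0, complete_space} \<Rightarrow> 'k set"
  where "K0 T = closure (QpT T)"

text \<open>
  The prescribed valuation ring fixes the absolute value on \<open>\<rat>\<^sub>p(T)\<close> up to equivalence;
  \<open>\<bar>p\<bar> = 1/p\<close> is the normalisation.
\<close>

locale gauss_tower =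
  fixes p :: nat
    and T :: "'k::{field_char_0, complete_space}"
    and K0bar :: "'k set"
  assumes prime_p: "Factorial_Ring.prime p"
    and dist_absval: "dist x y = absval (x - y :: 'k)"
    and absval_mult: "absval (x * y :: 'k) = absval x * absval y"
    and absval_add: "absval (x + y :: 'k) \<le> max (absval x) (absval y)"
    and absval_p: "absval (of_nat p :: 'k) = 1 / real p"
    and T_transcendental: "f \<in> polys_over Qp \<Longrightarrow> Polynomial.poly f T = 0 \<Longrightarrow> f = 0"
    and val_ring_QpT: "{x \<in> QpT T. absval x \<le> 1} = ZpT_loc p T"
    and K0bar_closure: "algebraic_closure (sub_ring K0bar) (K0 T)"
    and K0bar_dense: "closure K0bar = UNIV"

definition root_system ::
    "nat \<Rightarrow> 'k::{field_char_0, complete_space} set \<Rightarrow> 'k \<Rightarrow> (nat \<Rightarrow> 'k) \<Rightarrow> bool"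
  where "root_system p S a r \<longleftrightarrow>
    r 0 = a \<and> (\<forall>n. r n \<in> carrier (val_ring S) \<and> r (Suc n) ^ p = r n)"


section \<open>Witt vectors\<close>

text \<open>Integral polynomials in the variables \<open>X\<^sub>i\<close> (index \<open>Inl i\<close>) and \<open>Y\<^sub>i\<close> (index \<open>Inr i\<close>).\<close>

type_synonym witt_poly = "((nat + nat) \<Rightarrow>\<^sub>0 nat) \<Rightarrow>\<^sub>0 int"

definition pvar :: "nat + nat \<Rightarrow> witt_poly"
  where "pvar v = Poly_Mapping.single (Poly_Mapping.single v 1) 1"

definition poly_eval :: "('a, 'b) ring_scheme \<Rightarrow> (nat + nat \<Rightarrow> 'a) \<Rightarrow> witt_poly \<Rightarrow> 'a"
  where "poly_eval R a F =
    (\<Oplus>\<^bsub>R\<^esub>m\<in>Poly_Mapping.keys F. [Poly_Mapping.lookup F m] \<cdot>\<^bsub>R\<^esub>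
       (\<Otimes>\<^bsub>R\<^esub>v\<in>Poly_Mapping.keys m. a v [^]\<^bsub>R\<^esub> Poly_Mapping.lookup m v))"

definition ghost :: "nat \<Rightarrow> (nat \<Rightarrow> witt_poly) \<Rightarrow> nat \<Rightarrow> witt_poly"
  where "ghost p F n = (\<Sum>i\<le>n. of_nat p ^ i * F i ^ (p ^ (n - i)))"

text \<open>
  By Witt's theorem the ghost equations have exactly one solution over the integers.
\<close>

definition witt_sum :: "nat \<Rightarrow> nat \<Rightarrow> witt_poly"
  where "witt_sum p = (THE S. \<forall>n. ghost p S n =
     ghost p (\<lambda>i. pvar (Inl i)) n + ghost p (\<lambda>i. pvar (Inr i)) n)"

definition witt_prod :: "nat \<Rightarrow> nat \<Rightarrow> witt_poly"
  where "witt_prod p = (THE P. \<forall>n. ghost p P n =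
     ghost p (\<lambda>i. pvar (Inl i)) n * ghost p (\<lambda>i. pvar (Inr i)) n)"

definition teich :: "('a, 'b) ring_scheme \<Rightarrow> 'a \<Rightarrow> nat \<Rightarrow> 'a"
  where "teich R a = (\<lambda>n. if n = 0 then a else \<zero>\<^bsub>R\<^esub>)"

definition witt_ring :: "nat \<Rightarrow> ('a, 'b) ring_scheme \<Rightarrow> (nat \<Rightarrow> 'a) ring"
  where "witt_ring p R =
    \<lparr>carrier = {x. \<forall>n. x n \<in> carrier R},
     monoid.mult = (\<lambda>x y n. poly_eval R (case_sum x y) (witt_prod p n)),
     one = teich R \<one>\<^bsub>R\<^esub>,
     ring.zero = (\<lambda>n. \<zero>\<^bsub>R\<^esub>),
     add = (\<lambda>x y n. poly_eval R (case_sum x y) (witt_sum p n))\<rparr>"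


section \<open>The tilt, $A_{\mathrm{inf}}$ and Fontaine's map\<close>

definition frob_limit :: "nat \<Rightarrow> ('a, 'b) ring_scheme \<Rightarrow> (nat \<Rightarrow> 'a) ring"
  where "frob_limit p R =
    \<lparr>carrier = {x. \<forall>n. x n \<in> carrier R \<and> x (Suc n) [^]\<^bsub>R\<^esub> p = x n},
     monoid.mult = (\<lambda>x y n. x n \<otimes>\<^bsub>R\<^esub> y n),
     one = (\<lambda>n. \<one>\<^bsub>R\<^esub>),
     ring.zero = (\<lambda>n. \<zero>\<^bsub>R\<^esub>),
     add = (\<lambda>x y n. x n \<oplus>\<^bsub>R\<^esub> y n)\<rparr>"

abbreviation p_ideal :: "nat \<Rightarrow> 'k::{field_char_0, complete_space} set"
  where "p_ideal p \<equiv> PIdl\<^bsub>OK\<^esub> (of_nat p)"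

definition OK_flat :: "nat \<Rightarrow> (nat \<Rightarrow> 'k::{field_char_0, complete_space} set) ring"
  where "OK_flat p = frob_limit p (OK Quot p_ideal p)"

definition flat :: "nat \<Rightarrow> (nat \<Rightarrow> 'k) \<Rightarrow> nat \<Rightarrow> 'k::{field_char_0, complete_space} set"
  where "flat p r = (\<lambda>n. p_ideal p +>\<^bsub>OK\<^esub> r n)"

definition Ainf :: "nat \<Rightarrow> (nat \<Rightarrow> nat \<Rightarrow> 'k::{field_char_0, complete_space} set) ring"
  where "Ainf p = witt_ring p (OK_flat p)"

text \<open>
  An element of \<open>\<O>\<^sub>K/p\<close> is a coset, i.e. the set of its lifts. The limit does not depend on the
  lifts, and the finitely many terms with \<open>k < n\<close> are irrelevant.
\<close>

definition sharp :: "nat \<Rightarrow> nat \<Rightarrow> (nat \<Rightarrow> 'k::{field_char_0, complete_space} set) \<Rightarrow> 'k"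
  where "sharp p n x = lim (\<lambda>k. (SOME y. y \<in> x k) ^ (p ^ (k - n)))"

definition theta :: "nat \<Rightarrow> (nat \<Rightarrow> nat \<Rightarrow> 'k::{field_char_0, complete_space} set) \<Rightarrow> 'k"
  where "theta p x = suminf (\<lambda>n. of_nat p ^ n * sharp p n (x n))"


section \<open>Kaehler differentials\<close>

text \<open>
  The library represents a module by a record extending that of rings; the multiplicative fields
  \<open>mult\<close> and \<open>one\<close> are meaningless and left undefined.
\<close>

definition free_module :: "('a, 'b) ring_scheme \<Rightarrow> 'i set \<Rightarrow> ('a, 'i \<Rightarrow> 'a) module"
  where "free_module R I =
    \<lparr>carrier = {f. range f \<subseteq> carrier R \<and> finite {i. f i \<noteq> \<zero>\<^bsub>R\<^esub>} \<and> {i. f i \<noteq> \<zero>\<^bsub>R\<^esub>} \<subseteq> I},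
     monoid.mult = undefined, one = undefined,
     ring.zero = (\<lambda>i. \<zero>\<^bsub>R\<^esub>),
     add = (\<lambda>f g i. f i \<oplus>\<^bsub>R\<^esub> g i),
     smult = (\<lambda>c f i. c \<otimes>\<^bsub>R\<^esub> f i)\<rparr>"

definition free_gen :: "('a, 'b) ring_scheme \<Rightarrow> 'i \<Rightarrow> 'i \<Rightarrow> 'a"
  where "free_gen R i = (\<lambda>j. if j = i then \<one>\<^bsub>R\<^esub> else \<zero>\<^bsub>R\<^esub>)"

definition gen_submodule ::
    "('a, 'b) ring_scheme \<Rightarrow> ('a, 'm, 'c) module_scheme \<Rightarrow> 'm set \<Rightarrow> 'm set"
  where "gen_submodule R M E = \<Inter>{H. submodule H R M \<and> E \<subseteq> H}"

definition quot_module :: "('a, 'm, 'c) module_scheme \<Rightarrow> 'm set \<Rightarrow> ('a, 'm set) module"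
  where "quot_module M N =
    \<lparr>carrier = a_rcosets\<^bsub>M\<^esub> N,
     monoid.mult = undefined, one = undefined,
     ring.zero = N,
     add = set_add M,
     smult = (\<lambda>c C. \<Union>m\<in>C. N +>\<^bsub>M\<^esub> (c \<odot>\<^bsub>M\<^esub> m))\<rparr>"

definition kaehler_rels :: "('a, 'b) ring_scheme \<Rightarrow> 'a set \<Rightarrow> ('a \<Rightarrow> 'a) set"
  where "kaehler_rels B A =
    (let F = free_module B (carrier B); D = free_gen B in
      {D (x \<oplus>\<^bsub>B\<^esub> y) \<ominus>\<^bsub>F\<^esub> (D x \<oplus>\<^bsub>F\<^esub> D y) | x y. x \<in> carrier B \<and> y \<in> carrier B}
    \<union> {D (x \<otimes>\<^bsub>B\<^esub> y) \<ominus>\<^bsub>F\<^esub> (x \<odot>\<^bsub>F\<^esub> D y \<oplus>\<^bsub>F\<^esub> y \<odot>\<^bsub>F\<^esub> D x) | x y. x \<in> carrier B \<and> y \<in> carrier B}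
    \<union> D ` A)"

definition kaehler_sub :: "('a, 'b) ring_scheme \<Rightarrow> 'a set \<Rightarrow> ('a \<Rightarrow> 'a) set"
  where "kaehler_sub B A = gen_submodule B (free_module B (carrier B)) (kaehler_rels B A)"

definition kaehler :: "('a, 'b) ring_scheme \<Rightarrow> 'a set \<Rightarrow> ('a, ('a \<Rightarrow> 'a) set) module"
  where "kaehler B A = quot_module (free_module B (carrier B)) (kaehler_sub B A)"

definition kaehler_d :: "('a, 'b) ring_scheme \<Rightarrow> 'a set \<Rightarrow> 'a \<Rightarrow> ('a \<Rightarrow> 'a) set"
  where "kaehler_d B A x = kaehler_sub B A +>\<^bsub>free_module B (carrier B)\<^esub> free_gen B x"


section \<open>The module \<open>\<T>\<close>\<close>

text \<open>
  For a module \<open>M\<close> over the valuation ring of a dense subfield \<open>S\<close>, the limit of the \<open>M[p\<^sup>n]\<close> is an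
  \<open>\<O>\<^sub>K\<close>-module: \<open>a\<close> acts on \<open>M[p\<^sup>n]\<close> through any element of the valuation ring of \<open>S\<close> congruent
  to it modulo \<open>p\<^sup>n\<O>\<^sub>K\<close>.
\<close>

definition tate_module ::
    "nat \<Rightarrow> 'k::{field_char_0, complete_space} set \<Rightarrow> ('k, 'm) module \<Rightarrow> ('k, nat \<Rightarrow> 'm) module"
  where "tate_module p S M =
    \<lparr>carrier = {w. \<forall>n. w n \<in> carrier M \<and> [(p ^ n)] \<cdot>\<^bsub>M\<^esub> w n = \<zero>\<^bsub>M\<^esub> \<and> [p] \<cdot>\<^bsub>M\<^esub> w (Suc n) = w n},
     monoid.mult = undefined, one = undefined,
     ring.zero = (\<lambda>n. \<zero>\<^bsub>M\<^esub>),
     add = (\<lambda>w w' n. w n \<oplus>\<^bsub>M\<^esub> w' n),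
     smult = (\<lambda>a w n.
       (SOME b. b \<in> carrier (val_ring S) \<and> (\<exists>c\<in>carrier OK. a - b = of_nat p ^ n * c)) \<odot>\<^bsub>M\<^esub> w n)\<rparr>"

definition TT :: "nat \<Rightarrow> 'k::{field_char_0, complete_space} \<Rightarrow> 'k set
    \<Rightarrow> ('k, nat \<Rightarrow> ('k \<Rightarrow> 'k) set) module"
  where "TT p T K0bar =
    tate_module p K0bar (kaehler (val_ring K0bar) (carrier (val_ring (K0 T))))"

text \<open>
  \<open>d_theta p T K0bar r\<close> is $\mathrm{d}_\theta[X^\flat]$ for the root system \<open>r n = X\<^bsup>1/p^n\<^esup>\<close>, so that
  \<open>X\<^bsup>1-1/p^n\<^esup>\<close> is \<open>r n ^ (p ^ n - 1)\<close>.
\<close>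

definition d_theta :: "nat \<Rightarrow> 'k::{field_char_0, complete_space} \<Rightarrow> 'k set \<Rightarrow> (nat \<Rightarrow> 'k)
    \<Rightarrow> nat \<Rightarrow> ('k \<Rightarrow> 'k) set"
  where "d_theta p T K0bar r = (\<lambda>n.
    let B = val_ring K0bar; A = carrier (val_ring (K0 T)) in
      (r n ^ (p ^ n - 1)) \<odot>\<^bsub>kaehler B A\<^esub> kaehler_d B A (r n))"

end

theory Submission
  imports Defs "HOL-Library.Function_Algebras"
begin

text \<open>
  On Witt vectors over \<open>\<O>\<close>, the valuation ring of \<open>K0bar\<close>, let \<open>w\<^sub>n\<close> be the \<open>n\<close>-th ghost component. The map
  \<open>\<delta>\<^sub>n(x) = \<Sum>\<^sub>i\<^sub>\<le>\<^sub>n x\<^sub>i\<^bsup>p^(n-i)-1\<^esup> dx\<^sub>i\<close> to the Kaehler differentials, formally \<open>p\<^bsup>-n\<^esup> dw\<^sub>n(x)\<close>, is a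
  derivation over \<open>w\<^sub>n\<close>, and it sends \<open>[X\<^bsup>1/p^n\<^esup>]\<close> to the \<open>n\<close>-th component of \<open>d\<^sub>\<theta>[X\<^bsup>\<flat>\<^esup>]\<close>.
  At level \<open>n\<close> of the tilt, the given equation says that the Witt vectors
  \<open>[T\<^bsup>1/p^n\<^esup>] + [(1-T)\<^bsup>1/p^n\<^esup>] - 1\<close> and \<open>a([p\<^bsup>1/p^n\<^esup>] - p)\<close> over \<open>\<O>\<close> have components congruent
  modulo \<open>p\<close>, where \<open>a\<close> lifts the image of \<open>A\<close>. For both \<open>w\<^sub>n\<close> vanishes, and two Witt vectors that are
  congruent modulo \<open>p\<close> and have the same \<open>w\<^sub>n\<close> have the same \<open>\<delta>\<^sub>n\<close>. Since \<open>w\<^sub>n([p\<^bsup>1/p^n\<^esup>] - p) = 0\<close>,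
  the second value is \<open>w\<^sub>n(a) \<delta>\<^sub>n([p\<^bsup>1/p^n\<^esup>])\<close>, and finally \<open>w\<^sub>n(a) \<equiv> \<theta>(A)\<close> modulo \<open>p\<^sup>n\<close>, which
  annihilates \<open>\<delta>\<^sub>n([p\<^bsup>1/p^n\<^esup>])\<close>.
\<close>


section \<open>Integral polynomials\<close>

definition monom_eval :: "('v \<Rightarrow> 'r::comm_ring_1) \<Rightarrow> ('v \<Rightarrow>\<^sub>0 nat) \<Rightarrow> 'r"
  where "monom_eval a m = (\<Prod>v\<in>Poly_Mapping.keys m. a v ^ Poly_Mapping.lookup m v)"

text \<open>The type-class counterpart of \<open>poly_eval\<close>. Any commutative ring is allowed
  as target, so substitutions into \<open>witt_poly\<close> and into univariate polynomials over
  \<open>witt_poly\<close> are instances too.\<close>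

definition ev :: "('v \<Rightarrow> 'r::comm_ring_1) \<Rightarrow> (('v \<Rightarrow>\<^sub>0 nat) \<Rightarrow>\<^sub>0 int) \<Rightarrow> 'r"
  where "ev a F = (\<Sum>m\<in>Poly_Mapping.keys F. of_int (Poly_Mapping.lookup F m) * monom_eval a m)"

lemma monom_eval_superset:
  assumes "finite V" "Poly_Mapping.keys m \<subseteq> V"
  shows "monom_eval a m = (\<Prod>v\<in>V. a v ^ Poly_Mapping.lookup m v)"
  unfolding monom_eval_def using assms
  by (intro prod.mono_neutral_left) (auto simp: in_keys_iff)

lemma monom_eval_add: "monom_eval a (m + m') = monom_eval a m * monom_eval a m'"
proof -
  let ?V = "Poly_Mapping.keys m \<union> Poly_Mapping.keys m'"
  have "monom_eval a k = (\<Prod>v\<in>?V. a v ^ Poly_Mapping.lookup k v)" if "k \<in> {m, m', m + m'}" for k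
    using that Poly_Mapping.keys_add[of m m'] by (intro monom_eval_superset) auto
  then show ?thesis by (simp add: lookup_add power_add prod.distrib)
qed

lemma monom_eval_0 [simp]: "monom_eval a 0 = 1"
  by (simp add: monom_eval_def)

lemma ev_superset:
  assumes "finite M" "Poly_Mapping.keys F \<subseteq> M"
  shows "ev a F = (\<Sum>m\<in>M. of_int (Poly_Mapping.lookup F m) * monom_eval a m)"
  unfolding ev_def using assms
  by (intro sum.mono_neutral_left) (auto simp: in_keys_iff)

lemma ev_add [simp]: "ev a (F + G) = ev a F + ev a G"
proof -
  let ?M = "Poly_Mapping.keys F \<union> Poly_Mapping.keys G"
  have "ev a H = (\<Sum>m\<in>?M. of_int (Poly_Mapping.lookup H m) * monom_eval a m)"
    if "H \<in> {F, G, F + G}" for H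
    using that Poly_Mapping.keys_add[of F G] by (intro ev_superset) auto
  then show ?thesis by (simp add: lookup_add distrib_right sum.distrib)
qed

lemma ev_0 [simp]: "ev a 0 = 0"
  by (simp add: ev_def)

lemma ev_uminus [simp]: "ev a (- F) = - ev a F"
  using ev_add[of a F "- F"] by (simp add: add_eq_0_iff2)

lemma ev_diff [simp]: "ev a (F - G) = ev a F - ev a G"
  using ev_add[of a F "- G"] by simp

lemma ev_sum [simp]: "ev a (sum F I) = (\<Sum>i\<in>I. ev a (F i))"
  by (induction I rule: infinite_finite_induct) auto

lemma ev_single [simp]: "ev a (Poly_Mapping.single m c) = of_int c * monom_eval a m"
  by (simp add: ev_def)

text \<open>An integral polynomial is an element of the free abelian group on the monomials, so
  additive claims need only be checked on monomials with coefficient 1.\<close>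

lemmas frag_induct [case_names zero one diff] = frag_induction[OF subset_UNIV]

lemma ev_single_mult: "ev a (Poly_Mapping.single m 1 * G) = monom_eval a m * ev a G"
proof (induction G rule: frag_induct)
  case (one m')
  then show ?case by (simp add: mult_single monom_eval_add)
qed (auto simp: algebra_simps)

lemma ev_mult [simp]: "ev a (F * G) = ev a F * ev a G"
proof (induction F rule: frag_induct)
  case (one m)
  then show ?case by (simp add: ev_single_mult)
qed (auto simp: algebra_simps)

lemma ev_1 [simp]: "ev a 1 = 1"
  using ev_single[of a 0 1] by (simp del: ev_single)

lemma ev_power [simp]: "ev a (F ^ n) = ev a F ^ n"
  by (induction n) auto

lemma ev_of_nat [simp]: "ev a (of_nat n) = of_nat n"
  by (induction n) auto

lemma ev_prod [simp]: "ev a (prod F I) = (\<Prod>i\<in>I. ev a (F i))"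
  by (induction I rule: infinite_finite_induct) auto

lemma ev_pvar [simp]: "ev a (pvar v) = a v"
  by (simp add: pvar_def monom_eval_def)

lemma single_eq_prod_pvar:
  "Poly_Mapping.single m 1 = monom_eval pvar m"
proof -
  have pow: "pvar v ^ n = Poly_Mapping.single (Poly_Mapping.single v n) 1" for v n
    by (induction n) (simp_all add: pvar_def mult_single flip: single_add)
  have "(\<Prod>v\<in>V. Poly_Mapping.single (f v) (1::int)) = Poly_Mapping.single (sum f V) 1"
    if "finite V" for V and f :: "nat + nat \<Rightarrow> (nat + nat) \<Rightarrow>\<^sub>0 nat"
    using that by (induction V) (auto simp: mult_single)
  moreover have "(\<Sum>v\<in>Poly_Mapping.keys m. Poly_Mapping.single v (Poly_Mapping.lookup m v)) = m"
    by (rule poly_mapping_eqI)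
      (auto simp: lookup_sum lookup_single when_def in_keys_iff
        cong: if_cong)
  ultimately show ?thesis
    by (simp add: monom_eval_def pow)
qed

text \<open>The variables generate the ring of integral polynomials, so a property stable under the
  ring operations need only be checked on them and on 1.\<close>

lemma witt_poly_induct [case_names pvar one add mult uminus]:
  fixes P :: "witt_poly \<Rightarrow> bool"
  assumes pvar: "\<And>v. P (pvar v)" and one: "P 1"
    and add: "\<And>F G. P F \<Longrightarrow> P G \<Longrightarrow> P (F + G)"
    and mult: "\<And>F G. P F \<Longrightarrow> P G \<Longrightarrow> P (F * G)"
    and uminus: "\<And>F. P F \<Longrightarrow> P (- F)"
  shows "P F"
proof (induction F rule: frag_induct)
  case zero
  then show ?case using add[OF one uminus[OF one]] by simp
next
  case (one m)
  have pow: "P (pvar v ^ n)" for v n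
    using assms(1,2) by (induction n) (auto intro: mult)
  have "P (\<Prod>v\<in>V. pvar v ^ f v)" if "finite V" for V f
    using that by (induction V) (auto intro: mult pow assms(2))
  then show ?case by (simp add: single_eq_prod_pvar monom_eval_def)
next
  case (diff a b)
  then show ?case using add[OF diff(1) uminus[OF diff(2)]] by simp
qed

lemma of_nat_mult_cancel_witt_poly:
  fixes F G :: witt_poly
  assumes "k > 0" "of_nat k * F = of_nat k * G"
  shows "F = G"
proof (rule poly_mapping_eqI)
  fix m
  have *: "Poly_Mapping.lookup (of_nat n * H) m = int n * Poly_Mapping.lookup H m" for n and H :: witt_poly
    by (induction n) (auto simp: lookup_add algebra_simps)
  show "Poly_Mapping.lookup F m = Poly_Mapping.lookup G m"
    using *[of k F] *[of k G] assms by simp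
qed

text \<open>The variable \<open>v\<close> is replaced by itself plus a new indeterminate, whose
  linear coefficient is read off. The rules of differentiation then come from the multiplication of
  univariate polynomials.\<close>

definition pderivative :: "nat + nat \<Rightarrow> witt_poly \<Rightarrow> witt_poly"
  where "pderivative v F = Polynomial.coeff (ev (\<lambda>w. [:pvar w, if w = v then 1 else 0:]) F) 1"

lemma pderivative_pvar: "pderivative v (pvar w) = (if w = v then 1 else 0)"
  by (simp add: pderivative_def)

lemma pderivative_add: "pderivative v (F + G) = pderivative v F + pderivative v G"
  by (simp add: pderivative_def)

lemma pderivative_uminus: "pderivative v (- F) = - pderivative v F"
  by (simp add: pderivative_def)

lemma pderivative_sum: "pderivative v (sum F I) = (\<Sum>i\<in>I. pderivative v (F i))"
  by (simp add: pderivative_def Polynomial.coeff_sum)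

lemma pderivative_1 [simp]: "pderivative v 1 = 0"
  by (simp add: pderivative_def)

text \<open>Setting the new indeterminate to 0 undoes the substitution; this turns the linear
  coefficient of a product into the Leibniz rule.\<close>

lemma coeff_0_ev:
  "Polynomial.coeff (ev (\<lambda>w. [:pvar w, if w = v then 1 else 0:]) F) 0 = F"
  by (induction F rule: witt_poly_induct) (auto simp: Polynomial.coeff_mult)

lemma pderivative_mult: "pderivative v (F * G) = F * pderivative v G + G * pderivative v F"
  by (simp add: pderivative_def Polynomial.coeff_mult coeff_0_ev)

lemma pderivative_of_nat_mult: "pderivative v (of_nat n * F) = of_nat n * pderivative v F"
  by (induction n) (auto simp: algebra_simps pderivative_add pderivative_def)

lemma pderivative_power: "pderivative v (F ^ n) = of_nat n * F ^ (n - 1) * pderivative v F"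
proof (induction n)
  case (Suc n)
  then show ?case
    by (cases n) (auto simp: pderivative_mult algebra_simps)
qed auto


section \<open>Ghost components\<close>

text \<open>The cofactor of \<open>a - b\<close> in \<open>a ^ p - b ^ p\<close> is congruent to
  \<open>p * b ^ (p - 1)\<close> modulo \<open>p\<close>, hence divisible by \<open>p\<close>, which
  gains one power. That \<open>p\<close> divides \<open>a - b\<close> comes from
  \<open>k > 0\<close>.\<close>

lemma dvd_power_diff_power:
  fixes a b :: "'r::comm_ring_1"
  assumes "of_nat p ^ k dvd a - b" "k > 0"
  shows "of_nat p ^ Suc k dvd a ^ p - b ^ p"
proof -
  define q :: 'r where "q = of_nat p"
  have q: "q dvd a - b"
    using assms by (auto simp: q_def intro: dvd_trans[OF dvd_power])
  have "q dvd (\<Sum>i<p. b ^ (p - Suc i) * a ^ i) - (\<Sum>i<p. b ^ (p - Suc i) * b ^ i)"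
    unfolding sum_subtractf[symmetric] right_diff_distrib[symmetric]
    using q by (intro dvd_sum dvd_mult) (auto simp: power_diff_sumr2)
  moreover have "(\<Sum>i<p. b ^ (p - Suc i) * b ^ i) = q * b ^ (p - 1)"
    by (simp add: q_def flip: power_add)
  ultimately have "q dvd (\<Sum>i<p. b ^ (p - Suc i) * a ^ i)"
    by (metis dvd_triv_left dvd_diffD dvd_add_right_iff diff_add_cancel)
  with assms show ?thesis
    unfolding power_diff_sumr2 q_def power_Suc2 by (intro mult_dvd_mono) auto
qed

lemma dvd_power_diff_power_power:
  fixes a b :: "'r::comm_ring_1"
  assumes "of_nat p dvd a - b"
  shows "of_nat p ^ Suc n dvd a ^ (p ^ n) - b ^ (p ^ n)"
proof (induction n)
  case (Suc n)
  from dvd_power_diff_power[OF this] show ?case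
    by (simp add: power_mult[symmetric] mult.commute)
qed (use assms in simp)

lemma dvd_add_power_diff:
  fixes a b :: "'r::comm_ring_1"
  assumes "Factorial_Ring.prime p"
  shows "of_nat p dvd (a + b) ^ p - (a ^ p + b ^ p)"
proof -
  have p: "p > 0" using assms by (simp add: prime_gt_0_nat)
  have split: "{..p} = insert 0 (insert p {0<..<p})" using p by auto
  have "(a + b) ^ p - (a ^ p + b ^ p) = (\<Sum>k\<in>{0<..<p}. of_nat (p choose k) * a ^ k * b ^ (p - k))"
    unfolding binomial_ring split using p by simp
  moreover have "of_nat p dvd (of_nat (p choose k) :: 'r)" if "k \<in> {0<..<p}" for k
    proof -
    have "p dvd (p choose k)" using that assms by (intro dvd_choose_prime) auto
    then show ?thesis by (metis dvdE dvd_triv_left of_nat_mult)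
  qed
  ultimately show ?thesis by (auto intro!: dvd_sum)
qed

section \<open>The lift of Frobenius to integral polynomials\<close>

definition frobenius_lift :: "nat \<Rightarrow> witt_poly \<Rightarrow> witt_poly"
  where "frobenius_lift p = ev (\<lambda>v. pvar v ^ p)"

text \<open>Modulo \<open>p\<close> both the \<open>p\<close>-th power and
  \<open>frobenius_lift p\<close> are ring homomorphisms, and they agree on the variables.\<close>

lemma frobenius_lift_cong:
  assumes p: "Factorial_Ring.prime p"
  shows "of_nat p dvd F ^ p - frobenius_lift p F"
  unfolding frobenius_lift_def
proof (induction F rule: witt_poly_induct)
  case (add F G)
  have "(F + G) ^ p - ev (\<lambda>v. pvar v ^ p) (F + G) = ((F + G) ^ p - (F ^ p + G ^ p))
     + (F ^ p - ev (\<lambda>v. pvar v ^ p) F) + (G ^ p - ev (\<lambda>v. pvar v ^ p) G)" by simp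
  then show ?case
    using add dvd_add_power_diff[OF p, of F G] by (metis dvd_add)
next
  case (mult F G)
  let ?e = "ev (\<lambda>v. pvar v ^ p)"
  have "(F * G) ^ p - ?e (F * G) = F ^ p * (G ^ p - ?e G) + ?e G * (F ^ p - ?e F)"
    by (simp add: algebra_simps power_mult_distrib)
  with mult show ?case by simp
next
  case (uminus F)
  let ?e = "ev (\<lambda>v. pvar v ^ p)"
  show ?case
  proof (cases "p = 2")
    \<comment> \<open>For \<open>p = 2\<close> the sign disappears in the power but not in
      \<open>?e\<close>; the defect \<open>2 * ?e F\<close> is a multiple of
      \<open>p\<close>.\<close>
    case True
    have "(- F) ^ p - ?e (- F) = (F ^ p - ?e F) + of_nat p * ?e F" 
      by (simp add: True)
    with uminus show ?thesis by (metis dvd_add dvd_triv_left)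
  next
    case False
    with p have "odd p" using primes_dvd_imp_eq two_is_prime_nat by blast
    then have "(- F) ^ p - ?e (- F) = - (F ^ p - ?e F)" by simp
    with uminus show ?thesis by (metis dvd_minus_iff)
  qed
qed auto

section \<open>The ghost map and Dwork's lemma\<close>

definition ghost_comp :: "nat \<Rightarrow> (nat \<Rightarrow> 'r::comm_ring_1) \<Rightarrow> nat \<Rightarrow> 'r"
  where "ghost_comp p x n = (\<Sum>i\<le>n. of_nat p ^ i * x i ^ (p ^ (n - i)))"

lemma ghost_eq_ghost_comp: "ghost p = ghost_comp p"
  by (intro ext) (simp add: ghost_def ghost_comp_def)

lemma ev_ghost: "ev a (ghost p F n) = ghost_comp p (\<lambda>i. ev a (F i)) n"
  by (simp add: ghost_def ghost_comp_def)

lemma ghost_comp_cong: "(\<And>i. i \<le> n \<Longrightarrow> x i = y i) \<Longrightarrow> ghost_comp p x n = ghost_comp p y n"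
  by (simp add: ghost_comp_def)

text \<open>Up to its last term, component \<open>Suc n\<close> is component \<open>n\<close> of the
  sequence of \<open>p\<close>-th powers; in this form consecutive components are compared through
  Frobenius.\<close>

lemma ghost_comp_Suc:
  "ghost_comp p x (Suc n) = (\<Sum>i\<le>n. of_nat p ^ i * (x i ^ p) ^ (p ^ (n - i))) + of_nat p ^ Suc n * x (Suc n)"
  by (simp add: ghost_comp_def Suc_diff_le flip: power_mult)

text \<open>Apart from \<open>p ^ i * x i\<close>, component \<open>i\<close> involves only earlier
  entries, so cancelling \<open>p ^ i\<close> recovers the entries successively.\<close>

lemma ghost_comp_inject:
  fixes x y :: "nat \<Rightarrow> 'r::comm_ring_1"
  assumes cancel: "\<And>n a b. of_nat p ^ n * a = (of_nat p ^ n * b :: 'r) \<Longrightarrow> a = b"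
    and eq: "\<And>n. n \<le> N \<Longrightarrow> ghost_comp p x n = ghost_comp p y n" and "i \<le> N"
  shows "x i = y i"
  using \<open>i \<le> N\<close>
proof (induction i rule: less_induct)
  case (less i)
  have split: "ghost_comp p z i = (\<Sum>j<i. of_nat p ^ j * z j ^ (p ^ (i - j))) + of_nat p ^ i * z i"
    for z :: "nat \<Rightarrow> 'r"
    by (simp add: ghost_comp_def flip: lessThan_Suc_atMost)
  have "(\<Sum>j<i. of_nat p ^ j * x j ^ (p ^ (i - j))) = (\<Sum>j<i. of_nat p ^ j * y j ^ (p ^ (i - j)))"
    using less by (intro sum.cong) auto
  with eq[OF less.prems] show ?case by (simp add: split) (rule cancel)
qed

lemma of_nat_power_mult_cancel_witt_poly:
  fixes F G :: witt_poly
  assumes "p > 0" "of_nat p ^ n * F = of_nat p ^ n * G"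
  shows "F = G"
  using assms of_nat_mult_cancel_witt_poly[of "p ^ n" F G] by simp

text \<open>Dwork's lemma. Once the entries up to \<open>n\<close> are found, entry
  \<open>Suc n\<close> has to be \<open>g (Suc n)\<close> minus the terms of smaller index, divided
  by \<open>p ^ Suc n\<close>; the assumed congruence makes this difference divisible.\<close>

lemma dwork_ghost_exists:
  assumes p: "Factorial_Ring.prime p"
    and g: "\<And>n. of_nat p ^ Suc n dvd g (Suc n) - frobenius_lift p (g n)"
  shows "\<exists>!F. \<forall>n. ghost p F n = g n"
proof -
  have p0: "p > 0" using p by (simp add: prime_gt_0_nat)
  have "\<exists>F. \<forall>m\<le>n. ghost_comp p F m = g m" for n
  proof (induction n)
    case 0
    show ?case by (rule exI[of _ "\<lambda>_. g 0"]) (simp add: ghost_comp_def)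
  next
    case (Suc n)
    then obtain F where F: "\<And>m. m \<le> n \<Longrightarrow> ghost_comp p F m = g m" by auto
    define s where "s = (\<Sum>i\<le>n. of_nat p ^ i * (F i ^ p) ^ (p ^ (n - i)))"
    \<comment> \<open>Termwise: \<open>F i ^ p\<close> and \<open>frobenius_lift p (F i)\<close>
      agree modulo \<open>p\<close>, their \<open>p ^ (n - i)\<close>-th powers modulo
      \<open>p ^ Suc (n - i)\<close>, and the factor \<open>p ^ i\<close> supplies the rest.\<close>
    have "of_nat p ^ Suc n dvd s - frobenius_lift p (ghost_comp p F n)"
      unfolding s_def ghost_comp_def frobenius_lift_def ev_sum sum_subtractf[symmetric]
    proof (rule dvd_sum)
      fix i assume "i \<in> {..n}"
      then have "of_nat p ^ Suc n = (of_nat p ^ i * of_nat p ^ Suc (n - i) :: witt_poly)"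
        unfolding power_add[symmetric] by simp
      moreover have "of_nat p ^ Suc (n - i) dvd (F i ^ p) ^ (p ^ (n - i)) - frobenius_lift p (F i) ^ (p ^ (n - i))"
        by (intro dvd_power_diff_power_power frobenius_lift_cong p)
      ultimately show "of_nat p ^ Suc n dvd of_nat p ^ i * (F i ^ p) ^ p ^ (n - i) -
          ev (\<lambda>v. pvar v ^ p) (of_nat p ^ i * F i ^ p ^ (n - i))"
        by (simp add: frobenius_lift_def mult_dvd_mono flip: right_diff_distrib)
    qed
    from dvd_diff[OF g[of n] this] have "of_nat p ^ Suc n dvd g (Suc n) - s"
      using F[of n] by (simp add: algebra_simps)
    then obtain h where "g (Suc n) - s = of_nat p ^ Suc n * h"
      by (rule dvdE)
    then have h: "g (Suc n) = s + of_nat p ^ Suc n * h"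
      by (simp add: algebra_simps)
    define F' where "F' = F(Suc n := h)"
    have "ghost_comp p F' m = g m" if "m \<le> Suc n" for m
    proof (cases "m = Suc n")
      case True
      have "(\<Sum>i\<le>n. of_nat p ^ i * (F' i ^ p) ^ (p ^ (n - i))) = s"
        by (simp add: s_def F'_def)
      with h show ?thesis unfolding True ghost_comp_Suc by (simp add: F'_def)
    next
      case False
      with that F[of m] show ?thesis
        by (subst ghost_comp_cong[of m F' F]) (auto simp: F'_def)
    qed
    then show ?case by blast
  qed
  then obtain F where F: "\<And>n m. m \<le> n \<Longrightarrow> ghost_comp p (F n) m = g m" by metis
  have inj: "x i = y i" if "\<And>n. n \<le> i \<Longrightarrow> ghost_comp p x n = ghost_comp p y n"
    for x y :: "nat \<Rightarrow> witt_poly" and i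
    by (rule ghost_comp_inject[OF of_nat_power_mult_cancel_witt_poly[OF p0] that le_refl])
  \<comment> \<open>The solutions for the various bounds are chosen independently; injectivity makes
    them agree where both are valid, so the diagonal solves all equations.\<close>
  have diag: "F n i = F i i" if "i \<le> n" for n i
    by (rule inj) (use that F in simp)
  have "ghost_comp p (\<lambda>i. F i i) n = ghost_comp p (F n) n" for n
    by (rule ghost_comp_cong) (rule diag[symmetric])
  then have "\<exists>F. \<forall>n. ghost p F n = g n"
    using F by (intro exI[of _ "\<lambda>i. F i i"]) (simp add: ghost_eq_ghost_comp)
  moreover have "F = G" if "\<forall>n. ghost p F n = g n" "\<forall>n. ghost p G n = g n" for F G
    by (rule ext, rule inj) (use that in \<open>simp add: ghost_eq_ghost_comp\<close>)
  ultimately show ?thesis by blast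
qed

section \<open>The universal polynomials of Witt vector arithmetic\<close>

definition witt_neg :: "nat \<Rightarrow> nat \<Rightarrow> witt_poly"
  where "witt_neg p = (THE N. \<forall>n. ghost p N n = - ghost p (\<lambda>i. pvar (Inl i)) n)"

text \<open>\<open>frobenius_lift\<close> replaces each variable by its \<open>p\<close>-th power,
  so only the last term of component \<open>Suc n\<close> is left over.\<close>

lemma dvd_ghost_pvar:
  "of_nat p ^ Suc n dvd ghost p (\<lambda>i. pvar (v i)) (Suc n) - frobenius_lift p (ghost p (\<lambda>i. pvar (v i)) n)"
proof -
  have "ghost p (\<lambda>i. pvar (v i)) (Suc n) - frobenius_lift p (ghost p (\<lambda>i. pvar (v i)) n)
    = of_nat p ^ Suc n * pvar (v (Suc n))"
    unfolding frobenius_lift_def ev_ghost ev_pvar unfolding ghost_eq_ghost_comp ghost_comp_Suc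
    by (simp add: ghost_comp_def)
  then show ?thesis by (metis dvd_triv_left)
qed

text \<open>Dwork's lemma supplies the unique existence behind \<open>THE\<close>; likewise for
  products and negatives below.\<close>

lemma ghost_witt_sum:
  assumes "Factorial_Ring.prime p"
  shows "ghost p (witt_sum p) n = ghost p (\<lambda>i. pvar (Inl i)) n + ghost p (\<lambda>i. pvar (Inr i)) n"
proof -
  have "\<exists>!S. \<forall>n. ghost p S n = ghost p (\<lambda>i. pvar (Inl i)) n + ghost p (\<lambda>i. pvar (Inr i)) n"
  proof (rule dwork_ghost_exists[OF assms])
    fix n
    show "of_nat p ^ Suc n dvd ghost p (\<lambda>i. pvar (Inl i)) (Suc n) + ghost p (\<lambda>i. pvar (Inr i)) (Suc n)
       - frobenius_lift p (ghost p (\<lambda>i. pvar (Inl i)) n + ghost p (\<lambda>i. pvar (Inr i)) n)"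
      using dvd_add[OF dvd_ghost_pvar[of p n Inl] dvd_ghost_pvar[of p n Inr]]
      by (simp add: frobenius_lift_def algebra_simps)
  qed
  from theI'[OF this] show ?thesis unfolding witt_sum_def by blast
qed

lemma ghost_witt_prod:
  assumes "Factorial_Ring.prime p"
  shows "ghost p (witt_prod p) n = ghost p (\<lambda>i. pvar (Inl i)) n * ghost p (\<lambda>i. pvar (Inr i)) n"
proof -
  have "\<exists>!P. \<forall>n. ghost p P n = ghost p (\<lambda>i. pvar (Inl i)) n * ghost p (\<lambda>i. pvar (Inr i)) n"
  proof (rule dwork_ghost_exists[OF assms])
    fix n
    let ?x = "ghost p (\<lambda>i. pvar (Inl i))" and ?y = "ghost p (\<lambda>i. pvar (Inr i))"
    have "?x (Suc n) * ?y (Suc n) - frobenius_lift p (?x n * ?y n) =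
      ?x (Suc n) * (?y (Suc n) - frobenius_lift p (?y n)) + frobenius_lift p (?y n) * (?x (Suc n) - frobenius_lift p (?x n))"
      by (simp add: frobenius_lift_def algebra_simps)
    then show "of_nat p ^ Suc n dvd ?x (Suc n) * ?y (Suc n) - frobenius_lift p (?x n * ?y n)"
      using dvd_ghost_pvar[of p n Inl] dvd_ghost_pvar[of p n Inr]
      by (metis dvd_add dvd_mult)
  qed
  from theI'[OF this] show ?thesis unfolding witt_prod_def by blast
qed

lemma ghost_witt_neg:
  assumes "Factorial_Ring.prime p"
  shows "ghost p (witt_neg p) n = - ghost p (\<lambda>i. pvar (Inl i)) n"
proof -
  have "\<exists>!S. \<forall>n. ghost p S n = - ghost p (\<lambda>i. pvar (Inl i)) n"
  proof (rule dwork_ghost_exists[OF assms])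
    fix n
    show "of_nat p ^ Suc n dvd - ghost p (\<lambda>i. pvar (Inl i)) (Suc n)
       - frobenius_lift p (- ghost p (\<lambda>i. pvar (Inl i)) n)"
      using dvd_ghost_pvar[of p n Inl, THEN dvd_minus_iff[THEN iffD2]]
      by (simp add: frobenius_lift_def algebra_simps)
  qed
  from theI'[OF this] show ?thesis unfolding witt_neg_def by blast
qed

definition witt_add :: "nat \<Rightarrow> (nat \<Rightarrow> 'r::comm_ring_1) \<Rightarrow> (nat \<Rightarrow> 'r) \<Rightarrow> nat \<Rightarrow> 'r"
  where "witt_add p x y i = ev (case_sum x y) (witt_sum p i)"

definition witt_mult :: "nat \<Rightarrow> (nat \<Rightarrow> 'r::comm_ring_1) \<Rightarrow> (nat \<Rightarrow> 'r) \<Rightarrow> nat \<Rightarrow> 'r"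
  where "witt_mult p x y i = ev (case_sum x y) (witt_prod p i)"

text \<open>Negating every entry is right only for odd \<open>p\<close>, hence the separate
  polynomials. \<open>x\<close> also fills the variables \<open>Inr i\<close>, a default value that
  stays in any subring containing the entries.\<close>

definition witt_uminus :: "nat \<Rightarrow> (nat \<Rightarrow> 'r::comm_ring_1) \<Rightarrow> nat \<Rightarrow> 'r"
  where "witt_uminus p x i = ev (case_sum x x) (witt_neg p i)"

definition witt_teich :: "'r::comm_ring_1 \<Rightarrow> nat \<Rightarrow> 'r"
  where "witt_teich a i = (if i = 0 then a else 0)"

lemma ghost_comp_witt_add:
  assumes "Factorial_Ring.prime p"
  shows "ghost_comp p (witt_add p x y) n = ghost_comp p x n + ghost_comp p y n"
  using arg_cong[OF ghost_witt_sum[OF assms, of n], of "ev (case_sum x y)"]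
  by (simp add: ev_ghost witt_add_def[abs_def])

lemma ghost_comp_witt_mult:
  assumes "Factorial_Ring.prime p"
  shows "ghost_comp p (witt_mult p x y) n = ghost_comp p x n * ghost_comp p y n"
  using arg_cong[OF ghost_witt_prod[OF assms, of n], of "ev (case_sum x y)"]
  by (simp add: ev_ghost witt_mult_def[abs_def])

lemma ghost_comp_witt_uminus:
  assumes "Factorial_Ring.prime p"
  shows "ghost_comp p (witt_uminus p x) n = - ghost_comp p x n"
  using arg_cong[OF ghost_witt_neg[OF assms, of n], of "ev (case_sum x x)"]
  by (simp add: ev_ghost witt_uminus_def[abs_def])

lemma ghost_comp_witt_teich:
  assumes "p > 0"
  shows "ghost_comp p (witt_teich a) n = a ^ (p ^ n)"
proof -
  have "ghost_comp p (witt_teich a) n = (\<Sum>i\<in>{0}. of_nat p ^ i * witt_teich a i ^ (p ^ (n - i)))"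
    unfolding ghost_comp_def using assms
    by (intro sum.mono_neutral_right) (auto simp: witt_teich_def zero_power)
  then show ?thesis by (simp add: witt_teich_def)
qed


section \<open>A derivation on Witt vectors\<close>

definition dghost :: "nat \<Rightarrow> (nat \<Rightarrow> witt_poly) \<Rightarrow> nat \<Rightarrow> nat + nat \<Rightarrow> witt_poly"
  where "dghost p F n v = (\<Sum>i\<le>n. F i ^ (p ^ (n - i) - 1) * pderivative v (F i))"

text \<open>Differentiating a \<open>p ^ (n - i)\<close>-th power produces the factor that completes
  \<open>p ^ i\<close> to \<open>p ^ n\<close>. So \<open>dghost\<close> is the gradient of the
  ghost component divided by \<open>p ^ n\<close>.\<close>

lemma pderivative_ghost: "pderivative v (ghost p F n) = of_nat p ^ n * dghost p F n v"
proof -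
  have "pderivative v (of_nat p ^ i * F i ^ (p ^ (n - i)))
      = of_nat p ^ n * (F i ^ (p ^ (n - i) - 1) * pderivative v (F i))" if "i \<le> n" for i
  proof -
    have "of_nat p ^ n = (of_nat p ^ i * of_nat p ^ (n - i) :: witt_poly)"
      unfolding power_add[symmetric] using that by simp
    then show ?thesis
      using pderivative_of_nat_mult[of v "p ^ i"] by (simp add: pderivative_power mult.assoc)
  qed
  then show ?thesis
    by (simp add: ghost_def dghost_def pderivative_sum sum_distrib_left)
qed

text \<open>A derivation of the subring \<open>B\<close> into a quotient by \<open>N\<close>,
  without forming the quotient: values are representatives in an ambient module and the rules hold
  modulo \<open>N\<close>. Type-class sums and \<open>ev\<close> thus remain usable for Kaehler
  differentials, which are cosets in a record.\<close>

locale derivation_modulo = Modules.module scale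
  for scale :: "'r::comm_ring_1 \<Rightarrow> 'm::ab_group_add \<Rightarrow> 'm" (infixr \<open>*s\<close> 75) +
  fixes B :: "'r set" and N :: "'m set" and D :: "'r \<Rightarrow> 'm"
  assumes one_closed: "1 \<in> B"
    and add_closed: "a \<in> B \<Longrightarrow> b \<in> B \<Longrightarrow> a + b \<in> B"
    and mult_closed: "a \<in> B \<Longrightarrow> b \<in> B \<Longrightarrow> a * b \<in> B"
    and uminus_closed: "a \<in> B \<Longrightarrow> - a \<in> B"
    and N_0: "0 \<in> N"
    and N_add: "x \<in> N \<Longrightarrow> y \<in> N \<Longrightarrow> x + y \<in> N"
    and N_scale: "a \<in> B \<Longrightarrow> x \<in> N \<Longrightarrow> a *s x \<in> N"
    and D_add: "a \<in> B \<Longrightarrow> b \<in> B \<Longrightarrow> D (a + b) - (D a + D b) \<in> N"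
    and D_mult: "a \<in> B \<Longrightarrow> b \<in> B \<Longrightarrow> D (a * b) - (a *s D b + b *s D a) \<in> N"
begin

section \<open>Calculus of congruences modulo \<open>N\<close>\<close>

definition cong_N :: "'m \<Rightarrow> 'm \<Rightarrow> bool" (infix \<open>\<approx>\<^sub>N\<close> 50)
  where "x \<approx>\<^sub>N y \<longleftrightarrow> x - y \<in> N"

lemma N_uminus: "x \<in> N \<Longrightarrow> - x \<in> N"
  using N_scale[OF uminus_closed[OF one_closed], of x] by simp

lemma cong_N_refl [simp]: "x \<approx>\<^sub>N x"
  by (simp add: cong_N_def N_0)

lemma cong_N_sym: "x \<approx>\<^sub>N y \<Longrightarrow> y \<approx>\<^sub>N x"
  unfolding cong_N_def using N_uminus[of "x - y"] by simp

lemma cong_N_trans [trans]: "x \<approx>\<^sub>N y \<Longrightarrow> y \<approx>\<^sub>N z \<Longrightarrow> x \<approx>\<^sub>N z"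
  unfolding cong_N_def using N_add[of "x - y" "y - z"] by simp

lemma cong_N_add: "x \<approx>\<^sub>N y \<Longrightarrow> x' \<approx>\<^sub>N y' \<Longrightarrow> x + x' \<approx>\<^sub>N y + y'"
  unfolding cong_N_def using N_add[of "x - y" "x' - y'"] by (simp add: algebra_simps)

lemma cong_N_scale: "a \<in> B \<Longrightarrow> x \<approx>\<^sub>N y \<Longrightarrow> a *s x \<approx>\<^sub>N a *s y"
  unfolding cong_N_def scale_right_diff_distrib[symmetric] by (rule N_scale)

lemma cong_N_sum: "(\<And>i. i \<in> I \<Longrightarrow> f i \<approx>\<^sub>N g i) \<Longrightarrow> sum f I \<approx>\<^sub>N sum g I"
  by (induction I rule: infinite_finite_induct) (auto intro: cong_N_add)

lemma zero_closed: "0 \<in> B"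
  using add_closed[OF one_closed uminus_closed[OF one_closed]] by simp

lemma power_closed: "a \<in> B \<Longrightarrow> a ^ n \<in> B"
  by (induction n) (auto intro: one_closed mult_closed)

lemma of_nat_closed: "of_nat n \<in> B"
  by (induction n) (auto intro: zero_closed one_closed add_closed)

lemma sum_closed: "(\<And>i. i \<in> I \<Longrightarrow> f i \<in> B) \<Longrightarrow> sum f I \<in> B"
  by (induction I rule: infinite_finite_induct) (auto intro: zero_closed add_closed)

lemma ghost_comp_closed: "(\<And>i. x i \<in> B) \<Longrightarrow> ghost_comp p x n \<in> B"
  unfolding ghost_comp_def by (intro sum_closed mult_closed power_closed of_nat_closed)

lemma ev_closed: "(\<And>v. b v \<in> B) \<Longrightarrow> ev b (F :: witt_poly) \<in> B"
  by (induction F rule: witt_poly_induct)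
    (auto intro: one_closed add_closed mult_closed uminus_closed)

lemma D_0: "D 0 \<approx>\<^sub>N 0"
  using N_uminus[OF D_add[OF zero_closed zero_closed]] by (simp add: cong_N_def)

lemma D_1: "D 1 \<approx>\<^sub>N 0"
  using N_uminus[OF D_mult[OF one_closed one_closed]] by (simp add: cong_N_def)

lemma D_uminus:
  assumes "a \<in> B"
  shows "D (- a) \<approx>\<^sub>N - D a"
proof -
  have "- D a + (D a + D (- a)) \<approx>\<^sub>N - D a + D (a + - a)"
    using D_add[OF assms uminus_closed[OF assms]] by (intro cong_N_add[OF cong_N_refl] cong_N_sym[where x = "D (a + - a)"]) (simp add: cong_N_def)
  also have "\<dots> \<approx>\<^sub>N - D a + 0"
    using D_0 by (intro cong_N_add) auto
  finally show ?thesis by simp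
qed

text \<open>Expresses \<open>w\<close> as the sum of \<open>ev b (g v) *s D (b v)\<close> over all
  variables. Demanding this for all sufficiently large finite sets gives the infinite sum a meaning
  without tracking supports.\<close>

definition has_gradient :: "(nat + nat \<Rightarrow> 'r) \<Rightarrow> 'm \<Rightarrow> (nat + nat \<Rightarrow> witt_poly) \<Rightarrow> bool"
  where "has_gradient b w g \<longleftrightarrow>
    (\<forall>\<^sub>F V in finite_subsets_at_top UNIV. w \<approx>\<^sub>N (\<Sum>v\<in>V. ev b (g v) *s D (b v)))"

text \<open>Both representations hold on a common finite set, as the filter is nontrivial.
  Identities between differentials thus reduce to identities between polynomial gradients.\<close>

lemma has_gradient_unique:
  assumes "has_gradient b w g" "has_gradient b w' g"
  shows "w \<approx>\<^sub>N w'"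
proof -
  have "\<forall>\<^sub>F V in finite_subsets_at_top (UNIV :: (nat + nat) set). w \<approx>\<^sub>N w'"
    using assms unfolding has_gradient_def
    by eventually_elim (metis cong_N_sym cong_N_trans)
  then show ?thesis by simp
qed

lemma has_gradient_cong: "w \<approx>\<^sub>N w' \<Longrightarrow> has_gradient b w' g \<Longrightarrow> has_gradient b w g"
  unfolding has_gradient_def by (erule eventually_mono) (metis cong_N_trans)

lemma has_gradient_add:
  assumes "has_gradient b w g" "has_gradient b w' g'"
  shows "has_gradient b (w + w') (\<lambda>v. g v + g' v)"
  using assms unfolding has_gradient_def
  by eventually_elim (simp add: scale_left_distrib sum.distrib cong_N_add)

lemma has_gradient_0: "has_gradient b 0 (\<lambda>v. 0)"
  by (simp add: has_gradient_def)

lemma has_gradient_sum: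
  "(\<And>i. i \<in> I \<Longrightarrow> has_gradient b (w i) (g i)) \<Longrightarrow> has_gradient b (\<Sum>i\<in>I. w i) (\<lambda>v. \<Sum>i\<in>I. g i v)"
  by (induction I rule: infinite_finite_induct) (auto intro: has_gradient_0 has_gradient_add)

lemma has_gradient_scale:
  assumes "\<And>v. b v \<in> B" "has_gradient b w g"
  shows "has_gradient b (ev b F *s w) (\<lambda>v. F * g v)"
  using assms(2) unfolding has_gradient_def
proof eventually_elim
  case (elim V)
  from cong_N_scale[OF ev_closed[OF assms(1), where F = F] this] show ?case
    by (simp add: scale_sum_right)
qed

lemma has_gradient_uminus:
  assumes "\<And>v. b v \<in> B" "has_gradient b w g"
  shows "has_gradient b (- w) (\<lambda>v. - g v)"
  using has_gradient_scale[OF assms, where F = "- 1"] by simp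

text \<open>The chain rule: the rules for \<open>D\<close> modulo \<open>N\<close> match those for
  \<open>pderivative\<close>, and for a variable the sum has a single nonzero term.\<close>

lemma has_gradient_D:
  assumes b: "\<And>v. b v \<in> B"
  shows "has_gradient b (D (ev b F)) (\<lambda>v. pderivative v F)"
proof (induction F rule: witt_poly_induct)
  case (pvar w)
  have "\<forall>\<^sub>F V in finite_subsets_at_top UNIV. finite V \<and> w \<in> V"
    unfolding eventually_finite_subsets_at_top by (rule exI[of _ "{w}"]) auto
  then show ?case
    unfolding has_gradient_def
  proof eventually_elim
    case (elim V)
    have "(\<Sum>v\<in>V. ev b (pderivative v (pvar w)) *s D (b v)) = (\<Sum>v\<in>V. if w = v then D (b w) else 0)"
      by (intro sum.cong) (auto simp: pderivative_pvar)
    then show ?case using elim by simp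
  qed
next
  case one
  show ?case using has_gradient_cong[OF D_1 has_gradient_0] by simp
next
  case (add F G)
  have "D (ev b (F + G)) \<approx>\<^sub>N D (ev b F) + D (ev b G)"
    by (simp add: cong_N_def D_add ev_closed b)
  from has_gradient_cong[OF this has_gradient_add[OF add]] show ?case
    by (simp add: pderivative_add)
next
  case (mult F G)
  have "D (ev b (F * G)) \<approx>\<^sub>N ev b F *s D (ev b G) + ev b G *s D (ev b F)"
    by (simp add: cong_N_def D_mult ev_closed b)
  from has_gradient_cong[OF this has_gradient_add[OF has_gradient_scale[OF b mult(2), where F = F]
        has_gradient_scale[OF b mult(1), where F = G]]] show ?case
    by (simp add: pderivative_mult)
next
  case (uminus F)
  from has_gradient_cong[OF D_uminus[OF ev_closed[OF b]] has_gradient_uminus[OF b uminus]] show ?case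
    by (simp add: pderivative_uminus)
qed

text \<open>The chain rule for the monomial \<open>pvar (Inl 0) ^ n\<close>, every variable being
  assigned the value \<open>a\<close>.\<close>

lemma D_power:
  assumes "a \<in> B"
  shows "D (a ^ n) \<approx>\<^sub>N of_nat n *s a ^ (n - 1) *s D a"
proof (rule has_gradient_unique)
  let ?b = "\<lambda>_ :: nat + nat. a" and ?v = "Inl 0"
  show "has_gradient ?b (D (a ^ n)) (\<lambda>v. pderivative v (pvar ?v ^ n))"
    using has_gradient_D[of ?b "pvar ?v ^ n"] assms by simp
  have "has_gradient ?b (ev ?b (of_nat n) *s ev ?b (pvar ?v ^ (n - 1)) *s D (ev ?b (pvar ?v)))
      (\<lambda>v. of_nat n * (pvar ?v ^ (n - 1) * pderivative v (pvar ?v)))"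
    using assms by (intro has_gradient_scale has_gradient_D)
  then show "has_gradient ?b (of_nat n *s a ^ (n - 1) *s D a) (\<lambda>v. pderivative v (pvar ?v ^ n))"
    by (simp add: pderivative_power mult.assoc)
qed

text \<open>
  The operator \<open>F\<^sup>n d\<close> of the de Rham-Witt complex. Formally \<open>p\<^sup>n \<cdot> delta p n x\<close> is the differential
  of the ghost component \<open>ghost_comp p x n\<close>.
\<close>

definition delta :: "nat \<Rightarrow> nat \<Rightarrow> (nat \<Rightarrow> 'r) \<Rightarrow> 'm"
  where "delta p n x = (\<Sum>i\<le>n. x i ^ (p ^ (n - i) - 1) *s D (x i))"

lemma has_gradient_delta:
  assumes "\<And>v. b v \<in> B" "\<And>i. x i = ev b (F i)"
  shows "has_gradient b (delta p n x) (dghost p F n)"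
  unfolding delta_def dghost_def[abs_def] assms(2) ev_power[symmetric]
  by (intro has_gradient_sum has_gradient_scale has_gradient_D assms(1))

section \<open>Compatibility of \<open>delta\<close> with the Witt vector operations\<close>

context
  fixes p :: nat
  assumes p: "Factorial_Ring.prime p"
begin

text \<open>Division by \<open>p ^ n\<close> takes place here, among integral polynomials, which
  have no torsion; the differentials themselves have \<open>p\<close>-power torsion and do not allow
  it.\<close>

lemma dghost_eqI:
  assumes "\<And>v. pderivative v (ghost p F n) = of_nat p ^ n * g v"
  shows "dghost p F n = g"
  by (rule ext, rule of_nat_power_mult_cancel_witt_poly[OF prime_gt_0_nat[OF p], of n])
    (simp add: assms flip: pderivative_ghost)

text \<open>Here, and for products and negatives, the ghost equation is differentiated and divided
  by \<open>p ^ n\<close> as a polynomial identity, and only then evaluated at the entries.\<close>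

lemma delta_witt_add:
  assumes x: "\<And>i. x i \<in> B" and y: "\<And>i. y i \<in> B"
  shows "delta p n (witt_add p x y) \<approx>\<^sub>N delta p n x + delta p n y"
proof (rule has_gradient_unique)
  let ?b = "case_sum x y"
  have b: "?b v \<in> B" for v using x y by (cases v) auto
  have "dghost p (witt_sum p) n
    = (\<lambda>v. dghost p (\<lambda>i. pvar (Inl i)) n v + dghost p (\<lambda>i. pvar (Inr i)) n v)"
    by (rule dghost_eqI) (simp add: ghost_witt_sum[OF p] pderivative_add pderivative_ghost algebra_simps)
  with has_gradient_delta[OF b, where x = "witt_add p x y" and F = "witt_sum p" and p = p and n = n]
  show "has_gradient ?b (delta p n (witt_add p x y))
      (\<lambda>v. dghost p (\<lambda>i. pvar (Inl i)) n v + dghost p (\<lambda>i. pvar (Inr i)) n v)"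
    by (simp add: witt_add_def)
  show "has_gradient ?b (delta p n x + delta p n y)
      (\<lambda>v. dghost p (\<lambda>i. pvar (Inl i)) n v + dghost p (\<lambda>i. pvar (Inr i)) n v)"
    by (intro has_gradient_add has_gradient_delta b) auto
qed

lemma delta_witt_mult:
  assumes x: "\<And>i. x i \<in> B" and y: "\<And>i. y i \<in> B"
  shows "delta p n (witt_mult p x y)
    \<approx>\<^sub>N ghost_comp p x n *s delta p n y + ghost_comp p y n *s delta p n x"
proof (rule has_gradient_unique)
  let ?b = "case_sum x y"
  let ?X = "\<lambda>i. pvar (Inl i)" and ?Y = "\<lambda>i. pvar (Inr i)"
  let ?g = "\<lambda>v. ghost p ?X n * dghost p ?Y n v + ghost p ?Y n * dghost p ?X n v"
  have b: "?b v \<in> B" for v using x y by (cases v) auto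
  have "dghost p (witt_prod p) n = ?g"
    by (rule dghost_eqI) (simp add: ghost_witt_prod[OF p] pderivative_mult pderivative_ghost algebra_simps)
  with has_gradient_delta[OF b, where x = "witt_mult p x y" and F = "witt_prod p" and p = p and n = n]
  show "has_gradient ?b (delta p n (witt_mult p x y)) ?g"
    by (simp add: witt_mult_def)
  have "has_gradient ?b (ev ?b (ghost p ?X n) *s delta p n y + ev ?b (ghost p ?Y n) *s delta p n x) ?g"
    by (intro has_gradient_add has_gradient_scale has_gradient_delta b) auto
  then show "has_gradient ?b (ghost_comp p x n *s delta p n y + ghost_comp p y n *s delta p n x) ?g"
    by (simp add: ev_ghost)
qed

lemma delta_witt_uminus:
  assumes x: "\<And>i. x i \<in> B"
  shows "delta p n (witt_uminus p x) \<approx>\<^sub>N - delta p n x"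
proof (rule has_gradient_unique)
  let ?b = "case_sum x x"
  let ?g = "\<lambda>v. - dghost p (\<lambda>i. pvar (Inl i)) n v"
  have b: "?b v \<in> B" for v using x by (cases v) auto
  have "dghost p (witt_neg p) n = ?g"
    by (rule dghost_eqI) (simp add: ghost_witt_neg[OF p] pderivative_uminus pderivative_ghost)
  with has_gradient_delta[OF b, where x = "witt_uminus p x" and F = "witt_neg p" and p = p and n = n]
  show "has_gradient ?b (delta p n (witt_uminus p x)) ?g"
    by (simp add: witt_uminus_def)
  show "has_gradient ?b (- delta p n x) ?g"
    by (intro has_gradient_uminus has_gradient_delta b) auto
qed

lemma delta_witt_teich:
  shows "delta p n (witt_teich a) \<approx>\<^sub>N a ^ (p ^ n - 1) *s D a"
proof -
  \<comment> \<open>For \<open>i = n\<close> the exponent is 0, so this term is \<open>D 0\<close>,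
    which vanishes only modulo \<open>N\<close>.\<close>
  have "(\<Sum>i\<in>{1..n}. (witt_teich a i) ^ (p ^ (n - i) - 1) *s D (witt_teich a i)) \<approx>\<^sub>N 0"
    using cong_N_sum[of "{1..n}" "\<lambda>i. 0 ^ (p ^ (n - i) - 1) *s D 0" "\<lambda>_. 0"]
      cong_N_scale[OF power_closed[OF zero_closed] D_0]
    by (simp add: witt_teich_def)
  then have "a ^ (p ^ n - 1) *s D a + (\<Sum>i\<in>{1..n}. (witt_teich a i) ^ (p ^ (n - i) - 1) *s D (witt_teich a i))
    \<approx>\<^sub>N a ^ (p ^ n - 1) *s D a + 0" by (intro cong_N_add) auto
  moreover have "{..n} = insert 0 {1..n}" by auto
  ultimately show ?thesis
    by (simp add: delta_def witt_teich_def)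
qed

text \<open>
  The ghost components of two sequences congruent modulo \<open>p\<close> differ by \<open>p\<^sup>n\<^sup>+\<^sup>1\<close> times the value
  of an integral polynomial. This value vanishes here, hence so does its differential.
\<close>

lemma delta_cong:
  assumes y: "\<And>i. y i \<in> B" and c: "\<And>i. c i \<in> B"
    and x: "\<And>i. x i = y i + of_nat p * c i"
    and eq: "ghost_comp p x n = ghost_comp p y n"
    and cancel: "\<And>a n. of_nat p ^ n * a = (0 :: 'r) \<Longrightarrow> a = 0"
  shows "delta p n x \<approx>\<^sub>N delta p n y"
proof -
  let ?b = "case_sum y c"
  let ?Y = "\<lambda>i. pvar (Inl i)"
  let ?X = "\<lambda>i. ?Y i + of_nat p * pvar (Inr i)"
  have b: "?b v \<in> B" for v using y c by (cases v) auto
  have "of_nat p ^ Suc n dvd ghost p ?X n - ghost p ?Y n"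
    unfolding ghost_def sum_subtractf[symmetric]
  proof (rule dvd_sum)
    fix i assume "i \<in> {..n}"
    then have "of_nat p ^ Suc n = (of_nat p ^ i * of_nat p ^ Suc (n - i) :: witt_poly)"
      unfolding power_add[symmetric] by simp
    moreover have "of_nat p ^ Suc (n - i) dvd ?X i ^ (p ^ (n - i)) - ?Y i ^ (p ^ (n - i))"
      by (intro dvd_power_diff_power_power) simp
    ultimately show "of_nat p ^ Suc n dvd of_nat p ^ i * ?X i ^ (p ^ (n - i)) - of_nat p ^ i * ?Y i ^ (p ^ (n - i))"
      by (simp add: mult_dvd_mono flip: right_diff_distrib)
  qed
  then obtain H where "ghost p ?X n - ghost p ?Y n = of_nat p ^ Suc n * H" by (rule dvdE)
  then have H: "ghost p ?X n = ghost p ?Y n + of_nat p ^ Suc n * H" by (simp add: algebra_simps)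
  have "ghost_comp p x n = ghost_comp p y n + of_nat p ^ Suc n * ev ?b H"
    using arg_cong[OF H, of "ev ?b"] by (simp add: ev_ghost x[abs_def])
  with eq have "of_nat p ^ Suc n * ev ?b H = 0" by simp
  then have ev_H: "ev ?b H = 0" by (rule cancel)
  have "dghost p ?X n = (\<lambda>v. dghost p ?Y n v + of_nat p * pderivative v H)"
    using pderivative_of_nat_mult[of _ "p ^ Suc n" H]
    by (intro dghost_eqI) (simp add: H pderivative_add pderivative_ghost algebra_simps)
  with has_gradient_delta[OF b, where x = x and F = "?X" and p = p and n = n]
  have "has_gradient ?b (delta p n x) (\<lambda>v. dghost p ?Y n v + of_nat p * pderivative v H)"
    by (simp add: x)
  moreover have "has_gradient ?b (delta p n y + ev ?b (of_nat p) *s D (ev ?b H))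
      (\<lambda>v. dghost p ?Y n v + of_nat p * pderivative v H)"
    by (intro has_gradient_add has_gradient_scale has_gradient_delta has_gradient_D b) auto
  ultimately have "delta p n x \<approx>\<^sub>N delta p n y + of_nat p *s D 0"
    unfolding ev_H ev_of_nat by (rule has_gradient_unique)
  also have "\<dots> \<approx>\<^sub>N delta p n y + of_nat p *s 0"
    by (intro cong_N_add cong_N_scale D_0 of_nat_closed) auto
  finally show ?thesis by simp
qed

end

end


section \<open>Valuation rings and Kaehler differentials\<close>

lemma carrier_sub_ring [simp]: "carrier (sub_ring S) = S"
  and mult_sub_ring [simp]: "x \<otimes>\<^bsub>sub_ring S\<^esub> y = x * y"
  and one_sub_ring [simp]: "\<one>\<^bsub>sub_ring S\<^esub> = 1"
  and zero_sub_ring [simp]: "\<zero>\<^bsub>sub_ring S\<^esub> = 0"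
  and add_sub_ring [simp]: "x \<oplus>\<^bsub>sub_ring S\<^esub> y = x + y"
  by (simp_all add: sub_ring_def)

lemma carrier_val_ring: "carrier (val_ring S) = {x \<in> S. absval x \<le> 1}"
  and mult_val_ring [simp]: "x \<otimes>\<^bsub>val_ring S\<^esub> y = x * y"
  and one_val_ring [simp]: "\<one>\<^bsub>val_ring S\<^esub> = 1"
  and zero_val_ring [simp]: "\<zero>\<^bsub>val_ring S\<^esub> = 0"
  and add_val_ring [simp]: "x \<oplus>\<^bsub>val_ring S\<^esub> y = x + y"
  by (simp_all add: val_ring_def)

lemma cring_sub_ring:
  assumes "0 \<in> S" "1 \<in> S" "\<And>x y. x \<in> S \<Longrightarrow> y \<in> S \<Longrightarrow> x + y \<in> S"
    "\<And>x y. x \<in> S \<Longrightarrow> y \<in> S \<Longrightarrow> x * y \<in> S" "\<And>x. x \<in> S \<Longrightarrow> - x \<in> S"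
  shows "cring (sub_ring S)"
proof (rule cringI)
  show "abelian_group (sub_ring S)"
  proof (rule abelian_groupI)
    fix x assume "x \<in> carrier (sub_ring S)"
    then show "\<exists>y\<in>carrier (sub_ring S). y \<oplus>\<^bsub>sub_ring S\<^esub> x = \<zero>\<^bsub>sub_ring S\<^esub>"
      using assms(5) by (intro bexI[of _ "- x"]) auto
  qed (use assms in auto)
  show "Group.comm_monoid (sub_ring S)"
    by (rule Group.comm_monoidI) (use assms in auto)
qed (simp add: distrib_right)

lemma nat_pow_sub_ring [simp]: "x [^]\<^bsub>sub_ring S\<^esub> (n::nat) = x ^ n"
  by (induction n) (auto simp: nat_pow_def mult.commute)

lemma nat_pow_val_ring [simp]: "x [^]\<^bsub>val_ring S\<^esub> (n::nat) = x ^ n"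
  by (simp add: val_ring_def)

lemma add_free_module [simp]: "f \<oplus>\<^bsub>free_module R I\<^esub> g = (\<lambda>i. f i \<oplus>\<^bsub>R\<^esub> g i)"
  and zero_free_module [simp]: "\<zero>\<^bsub>free_module R I\<^esub> = (\<lambda>i. \<zero>\<^bsub>R\<^esub>)"
  and smult_free_module [simp]: "c \<odot>\<^bsub>free_module R I\<^esub> f = (\<lambda>i. c \<otimes>\<^bsub>R\<^esub> f i)"
  by (simp_all add: free_module_def)

lemma gen_submodule_closed:
  assumes "\<And>H. submodule H R M \<Longrightarrow> E \<subseteq> H \<Longrightarrow> x \<in> H"
  shows "x \<in> gen_submodule R M E"
  using assms by (auto simp: gen_submodule_def)

lemma gen_submodule_subset: "submodule H R M \<Longrightarrow> E \<subseteq> H \<Longrightarrow> gen_submodule R M E \<subseteq> H"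
  by (auto simp: gen_submodule_def)

lemma gen_submodule_generator: "x \<in> E \<Longrightarrow> x \<in> gen_submodule R M E"
  by (auto simp: gen_submodule_def)

lemma gen_submodule_zero: "\<zero>\<^bsub>M\<^esub> \<in> gen_submodule R M E"
  by (rule gen_submodule_closed) (auto simp: submodule_def subgroup_def)

lemma gen_submodule_add:
  assumes "x \<in> gen_submodule R M E" "y \<in> gen_submodule R M E"
  shows "x \<oplus>\<^bsub>M\<^esub> y \<in> gen_submodule R M E"
proof (rule gen_submodule_closed)
  fix H assume H: "submodule H R M" "E \<subseteq> H"
  then have "subgroup H (add_monoid M)" by (simp add: submodule_def)
  from subgroup.m_closed[OF this, of x y] assms gen_submodule_subset[OF H] show "x \<oplus>\<^bsub>M\<^esub> y \<in> H"
    by auto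
qed

lemma gen_submodule_smult:
  assumes "a \<in> carrier R" "x \<in> gen_submodule R M E"
  shows "a \<odot>\<^bsub>M\<^esub> x \<in> gen_submodule R M E"
proof (rule gen_submodule_closed)
  fix H assume H: "submodule H R M" "E \<subseteq> H"
  with assms gen_submodule_subset[OF H] show "a \<odot>\<^bsub>M\<^esub> x \<in> H"
    by (auto simp: submodule_def submodule_axioms_def)
qed

section \<open>The absolute value of \<open>K\<close> and divisibility by powers of
  \<open>p\<close>\<close>

context gauss_tower
begin

lemma p_pos: "p > 0"
  using prime_p by (simp add: prime_gt_0_nat)

lemma p_gt_1: "p > 1"
  using prime_gt_1_nat[OF prime_p] .

lemma absval_nonneg [simp]: "0 \<le> absval (x :: 'k)"
  by (simp add: absval_def)

lemma absval_0 [simp]: "absval (0 :: 'k) = 0"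
  by (simp add: absval_def)

lemma absval_eq_0 [simp]: "absval (x :: 'k) = 0 \<longleftrightarrow> x = 0"
  by (simp add: absval_def)

lemma absval_1 [simp]: "absval (1 :: 'k) = 1"
proof -
  have "absval (1 :: 'k) * absval (1 :: 'k) = absval (1 :: 'k) * 1"
    using absval_mult[of 1 1] by simp
  then show ?thesis by (subst (asm) mult_cancel_left) simp
qed

lemma absval_uminus [simp]: "absval (- x :: 'k) = absval x"
proof -
  have "absval (- 1 :: 'k) * absval (- 1 :: 'k) = 1"
    using absval_mult[of "- 1" "- 1"] by simp
  then have "absval (- 1 :: 'k) = 1"
    using absval_nonneg[of "- 1"] by (auto simp: square_eq_1_iff simp del: absval_nonneg)
  then show ?thesis using absval_mult[of "- 1" x] by simp
qed

lemma absval_diff: "absval (x - y :: 'k) \<le> max (absval x) (absval y)"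
  using absval_add[of x "- y"] by simp

lemma absval_diff_trans: "absval (x - z :: 'k) \<le> max (absval (x - y)) (absval (y - z))"
  using absval_add[of "x - y" "y - z"] by simp

lemma absval_power: "absval (x ^ n :: 'k) = absval x ^ n"
  by (induction n) (auto simp: absval_mult)

lemma absval_p_power: "absval (of_nat p ^ n :: 'k) = (1 / real p) ^ n"
  by (simp add: absval_power absval_p)

lemma mem_OK: "x \<in> carrier OK \<longleftrightarrow> absval (x :: 'k) \<le> 1"
  by (simp add: carrier_val_ring)

text \<open>The quotient by \<open>p ^ n\<close> exists in the field, and it is integral exactly
  under this bound. Divisibility questions become estimates of absolute values.\<close>

lemma p_power_dvd_iff: "(\<exists>c\<in>carrier OK. x = of_nat p ^ n * c) \<longleftrightarrow> absval (x :: 'k) \<le> (1 / real p) ^ n"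
proof
  assume le: "absval x \<le> (1 / real p) ^ n"
  have nz: "(of_nat p ^ n :: 'k) \<noteq> 0" using p_pos by simp
  have "absval (x / of_nat p ^ n) * absval (of_nat p ^ n :: 'k) = absval x"
    using nz by (simp flip: absval_mult)
  with le have "absval (x / of_nat p ^ n) * (1 / real p) ^ n \<le> 1 * (1 / real p) ^ n"
    by (simp only: absval_p_power mult_1)
  then have "absval (x / of_nat p ^ n) \<le> 1"
    using p_pos by (subst (asm) mult_le_cancel_right) auto
  then show "\<exists>c\<in>carrier OK. x = of_nat p ^ n * c"
    using nz by (intro bexI[of _ "x / of_nat p ^ n"]) (auto simp: mem_OK)
next
  assume "\<exists>c\<in>carrier OK. x = of_nat p ^ n * c"
  then show "absval x \<le> (1 / real p) ^ n"
    using p_pos by (auto simp: mem_OK absval_mult absval_p_power intro!: mult_right_le_one_le)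
qed

lemma cring_val_ring:
  assumes "0 \<in> S" "1 \<in> S" "\<And>x y. x \<in> S \<Longrightarrow> y \<in> S \<Longrightarrow> x + y \<in> S"
    "\<And>x y. x \<in> S \<Longrightarrow> y \<in> S \<Longrightarrow> x * y \<in> S" "\<And>x. x \<in> S \<Longrightarrow> - x \<in> S"
  shows "cring (val_ring (S :: 'k set))"
  unfolding val_ring_def
proof (rule cring_sub_ring)
  fix x y assume "x \<in> {x \<in> S. absval x \<le> 1}" "y \<in> {x \<in> S. absval x \<le> 1}"
  then show "x + y \<in> {x \<in> S. absval x \<le> 1}" "x * y \<in> {x \<in> S. absval x \<le> 1}"
    using assms absval_add[of x y] by (auto simp: absval_mult mult_le_one)
qed (use assms in auto)

lemma cring_OK: "cring (OK :: 'k ring)"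
  by (rule cring_val_ring) auto

section \<open>The algebraic closure and its valuation ring\<close>

sublocale closure_field: Ring.field "sub_ring K0bar"
  using K0bar_closure by (simp add: algebraic_closure_def)

lemma K0bar_0: "0 \<in> K0bar"
  and K0bar_1: "1 \<in> K0bar"
  and K0bar_add: "x \<in> K0bar \<Longrightarrow> y \<in> K0bar \<Longrightarrow> x + y \<in> K0bar"
  and K0bar_mult: "x \<in> K0bar \<Longrightarrow> y \<in> K0bar \<Longrightarrow> x * y \<in> K0bar"
  using closure_field.zero_closed closure_field.one_closed closure_field.add.m_closed
    closure_field.m_closed by simp_all

lemma K0bar_uminus: assumes "x \<in> K0bar" shows "- x \<in> K0bar"
proof -
  from assms obtain y where "y \<in> K0bar" "x + y = 0"
    using closure_field.add.r_inv_ex[of x] by auto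
  then show ?thesis by (metis add_eq_0_iff)
qed

lemma K0bar_divide: assumes "x \<in> K0bar" "y \<in> K0bar" "y \<noteq> 0" shows "x / y \<in> K0bar"
proof -
  have "y \<in> Units (sub_ring K0bar)"
    using closure_field.field_Units assms by simp
  then obtain z where "z \<in> K0bar" "y * z = 1" by (auto simp: Units_def)
  then have "x / y = x * z" using assms(3) by (simp add: field_simps)
  then show ?thesis using K0bar_mult[OF assms(1) \<open>z \<in> K0bar\<close>] by simp
qed

lemma K0bar_of_nat: "of_nat n \<in> K0bar"
  by (induction n) (auto intro: K0bar_0 K0bar_1 K0bar_add)

lemma of_nat_mem_K0: "of_nat n \<in> K0 T"
proof -
  have "subring (K0 T) (sub_ring K0bar)"
    using K0bar_closure subfieldE(1) by (auto simp: algebraic_closure_def)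
  from subringE(2,3,7)[OF this] show ?thesis by (induction n) auto
qed

abbreviation OB :: "'k set"
  where "OB \<equiv> carrier (val_ring K0bar)"

lemma cring_OB: "cring (val_ring K0bar)"
  by (rule cring_val_ring) (auto intro: K0bar_0 K0bar_1 K0bar_add K0bar_mult K0bar_uminus)

interpretation OB: cring "val_ring K0bar"
  by (rule cring_OB)

lemma OB_0: "0 \<in> OB" and OB_1: "1 \<in> OB"
  and OB_add: "x \<in> OB \<Longrightarrow> y \<in> OB \<Longrightarrow> x + y \<in> OB"
  and OB_mult: "x \<in> OB \<Longrightarrow> y \<in> OB \<Longrightarrow> x * y \<in> OB"
  using OB.zero_closed OB.one_closed OB.add.m_closed OB.m_closed by simp_all

lemma OB_uminus: "x \<in> OB \<Longrightarrow> - x \<in> OB"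
  by (auto simp: carrier_val_ring K0bar_uminus)

lemma OB_subset_OK: "x \<in> OB \<Longrightarrow> x \<in> carrier OK"
  by (simp add: carrier_val_ring)

text \<open>The cofactor found in \<open>OK\<close> is a quotient of elements of the field
  \<open>K0bar\<close>, so it already lies in \<open>OB\<close>.\<close>

lemma OB_p_power_dvd:
  assumes "x \<in> OB" "absval x \<le> (1 / real p) ^ n"
  obtains c where "c \<in> OB" "x = of_nat p ^ n * c"
proof -
  from assms(2) obtain c where c: "c \<in> carrier OK" "x = of_nat p ^ n * c"
    unfolding p_power_dvd_iff[symmetric] by blast
  have "c = x / of_nat p ^ n" using c p_pos by simp
  moreover have "of_nat p ^ n \<in> K0bar" using K0bar_of_nat[of "p ^ n"] by simp
  ultimately have "c \<in> K0bar"
    using assms(1) p_pos by (auto simp: carrier_val_ring intro!: K0bar_divide)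
  with c show ?thesis by (intro that[of c]) (auto simp: carrier_val_ring)
qed

section \<open>Kaehler differentials as a derivation modulo relations\<close>

definition OA :: "'k set"
  where "OA = carrier (val_ring (K0 T))"

definition OF :: "('k, 'k \<Rightarrow> 'k) module"
  where "OF = free_module (val_ring K0bar) OB"

definition relations :: "('k \<Rightarrow> 'k) set"
  where "relations = kaehler_sub (val_ring K0bar) OA"

definition differential :: "'k \<Rightarrow> 'k \<Rightarrow> 'k"
  where "differential x = (\<lambda>j. if j = x then 1 else 0)"

text \<open>Scaling on all functions, not only on finitely supported ones: this is the ambient
  module required by \<open>derivation_modulo\<close>.\<close>

definition fscale :: "'k \<Rightarrow> ('k \<Rightarrow> 'k) \<Rightarrow> 'k \<Rightarrow> 'k"
  where "fscale a f = (\<lambda>i. a * f i)"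

lemma free_gen_eq: "free_gen (val_ring K0bar) x = differential x"
  by (simp add: free_gen_def differential_def cong: if_cong)

lemma OF_add: "f \<oplus>\<^bsub>OF\<^esub> g = f + g"
  and OF_zero: "\<zero>\<^bsub>OF\<^esub> = 0"
  and OF_smult: "a \<odot>\<^bsub>OF\<^esub> f = fscale a f"
  by (auto simp: OF_def fun_eq_iff fscale_def)

lemma relations_eq: "relations = gen_submodule (val_ring K0bar) OF (kaehler_rels (val_ring K0bar) OA)"
  by (simp add: relations_def kaehler_sub_def OF_def)

lemma OF_carrier: "f \<in> carrier OF \<longleftrightarrow> range f \<subseteq> OB \<and> finite {i. f i \<noteq> 0} \<and> {i. f i \<noteq> 0} \<subseteq> OB"
  by (simp add: OF_def free_module_def)

lemma OF_carrierI:
  assumes "\<And>i. f i \<in> OB" "{i. f i \<noteq> 0} \<subseteq> I" "finite I" "I \<subseteq> OB"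
  shows "f \<in> carrier OF"
  unfolding OF_carrier
proof (intro conjI)
  show "range f \<subseteq> OB" using assms(1) by (rule image_subsetI)
  show "finite {i. f i \<noteq> 0}" using assms(2,3) by (rule finite_subset)
  show "{i. f i \<noteq> 0} \<subseteq> OB" using assms(2,4) by (rule order_trans)
qed

lemma OF_carrier_add:
  assumes "f \<in> carrier OF" "g \<in> carrier OF"
  shows "f + g \<in> carrier OF"
proof (rule OF_carrierI)
  show "(f + g) i \<in> OB" for i
    using assms unfolding plus_fun_def by (intro OB_add) (auto simp: OF_carrier)
  show "{i. (f + g) i \<noteq> 0} \<subseteq> {i. f i \<noteq> 0} \<union> {i. g i \<noteq> 0}" by auto
qed (use assms in \<open>simp_all add: OF_carrier\<close>)

lemma OF_carrier_scale:
  assumes "a \<in> OB" "f \<in> carrier OF"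
  shows "fscale a f \<in> carrier OF"
proof (rule OF_carrierI)
  show "fscale a f i \<in> OB" for i
    using assms unfolding fscale_def by (intro OB_mult) (auto simp: OF_carrier)
  show "{i. fscale a f i \<noteq> 0} \<subseteq> {i. f i \<noteq> 0}" by (auto simp: fscale_def)
qed (use assms in \<open>simp_all add: OF_carrier\<close>)

lemma OF_carrier_differential: "x \<in> OB \<Longrightarrow> differential x \<in> carrier OF"
  unfolding OF_carrier differential_def by (auto simp: OB_0 OB_1)

text \<open>Negation in a record is a description over its carrier, so \<open>g\<close> has to lie
  there; the pointwise negative lies there too and is the only candidate.\<close>

lemma OF_minus:
  assumes "g \<in> carrier OF"
  shows "f \<ominus>\<^bsub>OF\<^esub> g = f - g"
proof -
  have neg: "- g \<in> carrier OF" using assms by (auto simp: OF_carrier OB_uminus)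
  have "\<ominus>\<^bsub>OF\<^esub> g = - g"
    unfolding a_inv_def m_inv_def
  proof (rule the_equality)
    fix h assume "h \<in> carrier (add_monoid OF) \<and> g \<otimes>\<^bsub>add_monoid OF\<^esub> h = \<one>\<^bsub>add_monoid OF\<^esub>
      \<and> h \<otimes>\<^bsub>add_monoid OF\<^esub> g = \<one>\<^bsub>add_monoid OF\<^esub>"
    then have "g + h = 0" by (simp add: OF_add OF_zero)
    then show "h = - g" by (rule minus_unique[symmetric])
  qed (simp add: OF_add OF_zero neg)
  then show ?thesis by (simp add: a_minus_def OF_add)
qed

lemma kaehler_rels_eq:
  "kaehler_rels (val_ring K0bar) OA =
    {differential (x + y) - (differential x + differential y) | x y. x \<in> OB \<and> y \<in> OB}
  \<union> {differential (x * y) - (fscale x (differential y) + fscale y (differential x)) | x y. x \<in> OB \<and> y \<in> OB}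
  \<union> differential ` OA"
proof -
  have 1: "differential (x + y) \<ominus>\<^bsub>OF\<^esub> (differential x \<oplus>\<^bsub>OF\<^esub> differential y)
      = differential (x + y) - (differential x + differential y)" if "x \<in> OB" "y \<in> OB" for x y
    using that by (simp add: OF_add OF_minus OF_carrier_add OF_carrier_differential)
  have 2: "differential (x * y) \<ominus>\<^bsub>OF\<^esub> (x \<odot>\<^bsub>OF\<^esub> differential y \<oplus>\<^bsub>OF\<^esub> y \<odot>\<^bsub>OF\<^esub> differential x)
      = differential (x * y) - (fscale x (differential y) + fscale y (differential x))"
    if "x \<in> OB" "y \<in> OB" for x y
    using that by (simp add: OF_add OF_smult OF_minus OF_carrier_add OF_carrier_scale OF_carrier_differential)
  have F: "free_module (val_ring K0bar) OB = OF" and D: "free_gen (val_ring K0bar) = differential"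
    by (auto simp: OF_def free_gen_eq)
  show ?thesis
    unfolding kaehler_rels_def Let_def F D add_val_ring mult_val_ring
    by (intro arg_cong2[where f = "(\<union>)"] refl Collect_cong iff_exI) (auto simp: 1 2)
qed

text \<open>The sum and product relations are among the generators of \<open>relations\<close>; all
  results on \<open>delta\<close> thereby apply to differentials of \<open>OB\<close>.\<close>

sublocale kaehler: derivation_modulo fscale OB relations differential
proof unfold_locales
  fix a b :: 'k and x y :: "'k \<Rightarrow> 'k"
  show "fscale a (x + y) = fscale a x + fscale a y" "fscale (a + b) x = fscale a x + fscale b x"
    "fscale a (fscale b x) = fscale (a * b) x" "fscale 1 x = x"
    by (auto simp: fscale_def fun_eq_iff algebra_simps)
next
  show "0 \<in> relations"
    using gen_submodule_zero[of OF] unfolding relations_eq OF_zero .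
next
  fix x y assume "x \<in> relations" "y \<in> relations"
  then show "x + y \<in> relations"
    using gen_submodule_add[of x _ OF _ y] unfolding relations_eq OF_add by blast
next
  fix a x assume "a \<in> OB" "x \<in> relations"
  then show "fscale a x \<in> relations"
    using gen_submodule_smult[of a _ x OF] unfolding relations_eq OF_smult by blast
next
  fix a b assume "a \<in> OB" "b \<in> OB"
  then show "differential (a + b) - (differential a + differential b) \<in> relations"
    "differential (a * b) - (fscale a (differential b) + fscale b (differential a)) \<in> relations"
    unfolding relations_eq kaehler_rels_eq by (blast intro: gen_submodule_generator)+
qed (auto intro: OB_1 OB_add OB_mult OB_uminus)

section \<open>Cosets and the module operations of \<open>Omega\<close>\<close>

definition coset :: "('k \<Rightarrow> 'k) \<Rightarrow> ('k \<Rightarrow> 'k) set"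
  where "coset f = relations +>\<^bsub>OF\<^esub> f"

lemma coset_eq: "coset f = (\<lambda>h. h + f) ` relations"
  by (auto simp: coset_def a_r_coset_def r_coset_def OF_add)

lemma mem_coset: "g \<in> coset f \<longleftrightarrow> kaehler.cong_N g f"
proof
  assume "kaehler.cong_N g f"
  then show "g \<in> coset f"
    unfolding coset_eq kaehler.cong_N_def by (intro image_eqI[of _ _ "g - f"]) simp_all
qed (auto simp: coset_eq kaehler.cong_N_def)

lemma coset_eqI:
  assumes "kaehler.cong_N f g"
  shows "coset f = coset g"
proof (intro equalityI subsetI)
  fix h
  show "h \<in> coset f" if "h \<in> coset g"
    using that kaehler.cong_N_trans[OF _ kaehler.cong_N_sym[OF assms]] by (simp add: mem_coset)
  show "h \<in> coset g" if "h \<in> coset f"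
    using that kaehler.cong_N_trans[OF _ assms] by (simp add: mem_coset)
qed

abbreviation Omega :: "('k, ('k \<Rightarrow> 'k) set) module"
  where "Omega \<equiv> kaehler (val_ring K0bar) OA"

lemma Omega_add: "coset f \<oplus>\<^bsub>Omega\<^esub> coset g = coset (f + g)"
proof -
  have "coset f \<oplus>\<^bsub>Omega\<^esub> coset g = (\<Union>h\<in>coset f. \<Union>k\<in>coset g. {h + k})"
    by (simp add: kaehler_def quot_module_def set_add_def set_mult_def OF_add flip: OF_def)
  also have "\<dots> = coset (f + g)"
  proof (intro equalityI subsetI)
    fix x assume "x \<in> coset (f + g)"
    then have "x - g \<in> coset f" "g \<in> coset g"
      by (auto simp: mem_coset kaehler.cong_N_def kaehler.N_0 algebra_simps)
    then show "x \<in> (\<Union>h\<in>coset f. \<Union>k\<in>coset g. {h + k})" by force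
  qed (auto simp: mem_coset intro: kaehler.cong_N_add)
  finally show ?thesis .
qed

text \<open>The union defining the scalar multiple runs over all representatives; they give the same
  coset because \<open>relations\<close> is stable under \<open>OB\<close>.\<close>

lemma Omega_smult:
  assumes "a \<in> OB"
  shows "a \<odot>\<^bsub>Omega\<^esub> coset f = coset (fscale a f)"
proof -
  have "a \<odot>\<^bsub>Omega\<^esub> coset f = (\<Union>m\<in>coset f. coset (fscale a m))"
    by (simp add: kaehler_def quot_module_def coset_def OF_smult relations_def flip: OF_def)
  also have "\<dots> = (\<Union>m\<in>coset f. coset (fscale a f))"
    by (intro SUP_cong refl coset_eqI kaehler.cong_N_scale assms) (simp add: mem_coset)
  also have "\<dots> = coset (fscale a f)"
    using mem_coset[of f f] by auto
  finally show ?thesis .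
qed

lemma kaehler_d_eq: "kaehler_d (val_ring K0bar) OA x = coset (differential x)"
  by (simp add: kaehler_d_def coset_def free_gen_eq relations_def flip: OF_def)

lemma d_theta_eq:
  assumes "\<And>n. r n \<in> OB"
  shows "d_theta p T K0bar r n = coset (fscale (r n ^ (p ^ n - 1)) (differential (r n)))"
  unfolding d_theta_def Let_def OA_def[symmetric] kaehler_d_eq
  by (rule Omega_smult) (intro kaehler.power_closed assms)

lemma differential_OA: "x \<in> OA \<Longrightarrow> kaehler.cong_N (differential x) 0"
  unfolding kaehler.cong_N_def
  by (simp, unfold relations_eq kaehler_rels_eq, auto intro: gen_submodule_generator)

lemma differential_p: "kaehler.cong_N (differential (of_nat p)) 0"
  using p_gt_1 by (intro differential_OA) (simp add: OA_def carrier_val_ring of_nat_mem_K0 absval_p)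

end


section \<open>The ring $A_{\mathrm{inf}}$\<close>

lemma (in cring) finprod_nat_pow_closed:
  assumes "\<And>v. a v \<in> carrier R"
  shows "(\<Otimes>v\<in>I. a v [^] (f v :: nat)) \<in> carrier R"
  using assms by (intro finprod_closed) auto

lemma (in cring) poly_eval_closed:
  assumes "\<And>v. a v \<in> carrier R"
  shows "poly_eval R a F \<in> carrier R"
  unfolding poly_eval_def using assms
  by (intro finsum_closed Pi_I add.int_pow_closed finprod_nat_pow_closed)

text \<open>Serves to transport Witt polynomials along the projections from the tilt to its levels
  and along the reduction modulo \<open>p\<close>.\<close>

lemma (in ring_hom_cring) hom_poly_eval:
  assumes "\<And>v. a v \<in> carrier R"
  shows "h (poly_eval R a F) = poly_eval S (\<lambda>v. h (a v)) F"
proof -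
  have hom_pow_int: "h ([k] \<cdot> x) = [k] \<cdot>\<^bsub>S\<^esub> h x" if "x \<in> carrier R" for k :: int and x
    using group_hom.hom_int_pow[OF ring.a_group_hom, of x k] that by (simp add: add_pow_def)
  have "h (poly_eval R a F) = (\<Oplus>\<^bsub>S\<^esub>m\<in>Poly_Mapping.keys F.
      h ([Poly_Mapping.lookup F m] \<cdot> (\<Otimes>v\<in>Poly_Mapping.keys m. a v [^] Poly_Mapping.lookup m v)))"
    unfolding poly_eval_def using assms
    by (subst hom_finsum) (auto simp: comp_def intro!: R.add.int_pow_closed R.finprod_nat_pow_closed)
  also have "\<dots> = poly_eval S (\<lambda>v. h (a v)) F"
    unfolding poly_eval_def
  proof (intro S.finsum_cong' refl)
    fix m :: "nat + nat \<Rightarrow>\<^sub>0 nat"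
    have "h (\<Otimes>v\<in>Poly_Mapping.keys m. a v [^] Poly_Mapping.lookup m v)
      = (\<Otimes>\<^bsub>S\<^esub>v\<in>Poly_Mapping.keys m. h (a v) [^]\<^bsub>S\<^esub> Poly_Mapping.lookup m v)"
      using assms by (subst hom_finprod) (auto simp: comp_def ring.hom_nat_pow intro!: R.nat_pow_closed S.finprod_cong')
    then show "h ([Poly_Mapping.lookup F m] \<cdot> (\<Otimes>v\<in>Poly_Mapping.keys m. a v [^] Poly_Mapping.lookup m v))
      = [Poly_Mapping.lookup F m] \<cdot>\<^bsub>S\<^esub> (\<Otimes>\<^bsub>S\<^esub>v\<in>Poly_Mapping.keys m. h (a v) [^]\<^bsub>S\<^esub> Poly_Mapping.lookup m v)"
      using assms by (simp add: hom_pow_int R.finprod_nat_pow_closed)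
  qed (use assms in \<open>auto intro!: S.add.int_pow_closed S.finprod_nat_pow_closed\<close>)
  finally show ?thesis .
qed

context
  fixes S :: "'a::field set"
  assumes cring_S: "cring (sub_ring S)"
begin

interpretation S: cring "sub_ring S" by (rule cring_S)

lemma a_inv_sub_ring: "x \<in> S \<Longrightarrow> \<ominus>\<^bsub>sub_ring S\<^esub> x = - x"
  using S.r_neg[of x] by (simp add: add_eq_0_iff)

lemma finsum_sub_ring:
  assumes "\<And>i. i \<in> I \<Longrightarrow> f i \<in> S"
  shows "finsum (sub_ring S) f I = sum f I"
  using assms
proof (induction I rule: infinite_finite_induct)
  case (insert i I)
  then show ?case by (subst S.finsum_insert) auto
qed (simp_all add: S.finsum_infinite)

lemma finprod_sub_ring:
  assumes "\<And>i. i \<in> I \<Longrightarrow> f i \<in> S"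
  shows "finprod (sub_ring S) f I = prod f I"
  using assms
proof (induction I rule: infinite_finite_induct)
  case (insert i I)
  then show ?case by (subst S.finprod_insert) auto
qed (simp_all add: S.finprod_infinite)

lemma add_pow_nat_sub_ring: "[n] \<cdot>\<^bsub>sub_ring S\<^esub> x = of_nat n * x" for n :: nat
  by (induction n) (auto simp: add_pow_def nat_pow_def algebra_simps)

lemma add_pow_int_sub_ring:
  assumes "x \<in> S"
  shows "[k] \<cdot>\<^bsub>sub_ring S\<^esub> x = of_int k * x"
proof (cases "k \<ge> 0")
  case True
  then show ?thesis by (simp add: add_pow_int_ge add_pow_nat_sub_ring)
next
  case False
  have "of_nat n * x \<in> S" for n
    using S.add.nat_pow_closed[of x n] assms by (simp flip: add_pow_nat_sub_ring)
  from a_inv_sub_ring[OF this[of "nat (- k)"]] False show ?thesis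
    by (simp add: add_pow_int_lt add_pow_nat_sub_ring)
qed

text \<open>Sums, products and integer multiples in a subring are those of the ambient field; this
  links the record operations to the identities proved for \<open>ev\<close>.\<close>

lemma poly_eval_sub_ring:
  assumes "\<And>v. a v \<in> S"
  shows "poly_eval (sub_ring S) a F = ev a F"
proof -
  have pow: "a v ^ n \<in> S" for v n
    using S.nat_pow_closed[of "a v" n] assms by simp
  then have mon: "finprod (sub_ring S) (\<lambda>v. a v ^ Poly_Mapping.lookup m v) (Poly_Mapping.keys m) = monom_eval a m" for m
    by (simp add: finprod_sub_ring monom_eval_def)
  have mon_closed: "monom_eval a m \<in> S" for m
    using S.finprod_closed[of "\<lambda>v. a v ^ Poly_Mapping.lookup m v" "Poly_Mapping.keys m"] pow
    by (simp add: mon)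
  have "of_int k * monom_eval a m \<in> S" for k m
    using S.add.int_pow_closed[of "monom_eval a m" k] mon_closed
    by (simp add: add_pow_int_sub_ring)
  then show ?thesis
    by (simp add: poly_eval_def ev_def mon add_pow_int_sub_ring mon_closed finsum_sub_ring)
qed

end

context gauss_tower
begin

section \<open>The quotient \<open>Q\<close> of \<open>OK\<close> by \<open>p\<close> and the
  tilt\<close>

abbreviation Q :: "'k set ring"
  where "Q \<equiv> OK Quot p_ideal p"

definition red :: "'k \<Rightarrow> 'k set"
  where "red x = p_ideal p +>\<^bsub>OK\<^esub> x"

interpretation OK: cring "OK :: 'k ring"
  by (rule cring_OK)

lemma of_nat_mem_OK: "of_nat n \<in> carrier (OK :: 'k ring)"
proof (induction n)
  case (Suc n)
  then show ?case using absval_add[of 1 "of_nat n"] by (simp add: mem_OK)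
qed (simp add: mem_OK)

lemma ev_mem_OK:
  assumes "\<And>v. b v \<in> carrier (OK :: 'k ring)"
  shows "ev b (F :: witt_poly) \<in> carrier OK"
proof (induction F rule: witt_poly_induct)
  case (add F G)
  then show ?case using OK.add.m_closed by simp
next
  case (mult F G)
  then show ?case using OK.m_closed by simp
qed (use assms in \<open>auto simp: mem_OK\<close>)

lemma p_ideal_eq: "p_ideal p = {x :: 'k. absval x \<le> 1 / real p}"
proof -
  have "x \<in> p_ideal p \<longleftrightarrow> (\<exists>c\<in>carrier OK. x = of_nat p ^ 1 * c)" for x :: 'k
    by (auto simp: cgenideal_def mult.commute)
  then show ?thesis unfolding p_power_dvd_iff by auto
qed

lemma red_eq: "red x = {y. absval (y - x) \<le> 1 / real p}"
proof -
  have "y \<in> red x \<longleftrightarrow> y - x \<in> p_ideal p" for y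
    unfolding red_def a_r_coset_def' by (auto simp: algebra_simps intro: bexI[of _ "y - x"])
  then show ?thesis by (auto simp: p_ideal_eq)
qed

lemma red_eq_iff: "red x = red y \<longleftrightarrow> absval (x - y) \<le> 1 / real p"
proof
  assume "red x = red y"
  moreover have "x \<in> red x" by (simp add: red_eq)
  ultimately show "absval (x - y) \<le> 1 / real p" by (simp add: red_eq)
next
  assume le: "absval (x - y) \<le> 1 / real p"
  then have le': "absval (y - x) \<le> 1 / real p" using absval_uminus[of "x - y"] by simp
  show "red x = red y"
    unfolding red_eq
  proof (intro equalityI subsetI CollectI; drule CollectD)
    fix z assume "absval (z - x) \<le> 1 / real p"
    with le show "absval (z - y) \<le> 1 / real p" using absval_diff_trans[of z y x] by linarith
  next
    fix z assume "absval (z - y) \<le> 1 / real p"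
    with le' show "absval (z - x) \<le> 1 / real p" using absval_diff_trans[of z x y] by linarith
  qed
qed

lemma ideal_p: "ideal (p_ideal p) (OK :: 'k ring)"
  by (rule OK.cgenideal_ideal[OF of_nat_mem_OK])

lemma cring_Q: "cring Q"
  by (rule ideal.quotient_is_cring[OF ideal_p cring_OK])

interpretation Q: cring Q by (rule cring_Q)

lemma ring_hom_red: "ring_hom_cring OK Q red"
proof (intro ring_hom_cring.intro ring_hom_cring_axioms.intro cring_OK cring_Q)
  show "red \<in> ring_hom OK Q"
    using ideal.rcos_ring_hom[OF ideal_p] by (simp add: red_def[abs_def])
qed

interpretation red: ring_hom_cring OK Q red by (rule ring_hom_red)

lemma Q_cases:
  assumes "y \<in> carrier Q"
  obtains x where "x \<in> carrier OK" "y = red x"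
  using assms by (auto simp: FactRing_def A_RCOSETS_def' red_def)

lemma red_poly_eval:
  assumes "\<And>v. b v \<in> carrier OK"
  shows "poly_eval Q (\<lambda>v. red (b v)) F = red (ev b F)"
  using red.hom_poly_eval[of b F] poly_eval_sub_ring[of "{x. absval (x :: 'k) \<le> 1}" b F] assms cring_OK
  by (simp add: val_ring_def)

lemma red_power: "x \<in> carrier OK \<Longrightarrow> red x [^]\<^bsub>Q\<^esub> (n :: nat) = red (x ^ n)"
  using red.hom_pow[of x n] by simp

text \<open>The integral congruence for \<open>(X + Y) ^ p\<close> is evaluated at lifts to
  \<open>OK\<close>. Additivity is what closes the Frobenius limit under sums.\<close>

lemma frobenius_add:
  assumes "x \<in> carrier Q" "y \<in> carrier Q"
  shows "(x \<oplus>\<^bsub>Q\<^esub> y) [^]\<^bsub>Q\<^esub> p = x [^]\<^bsub>Q\<^esub> p \<oplus>\<^bsub>Q\<^esub> y [^]\<^bsub>Q\<^esub> p"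
proof -
  obtain V Y where V: "V \<in> carrier OK" "x = red V" and Y: "Y \<in> carrier OK" "y = red Y"
    using Q_cases[OF assms(1)] Q_cases[OF assms(2)] by metis
  let ?x = "pvar (Inl 0)" and ?y = "pvar (Inr 0)" and ?b = "case_sum (\<lambda>_. V) (\<lambda>_. Y)"
  obtain H where "(?x + ?y) ^ p - (?x ^ p + ?y ^ p) = of_nat p * H"
    using dvd_add_power_diff[OF prime_p, of ?x ?y] by (rule dvdE)
  from arg_cong[OF this, of "ev ?b"]
  have "(V + Y) ^ p - (V ^ p + Y ^ p) = of_nat p ^ 1 * ev ?b H" by simp
  moreover have "ev ?b H \<in> carrier OK"
    by (rule ev_mem_OK) (use V Y in \<open>auto split: sum.split\<close>)
  ultimately have "absval ((V + Y) ^ p - (V ^ p + Y ^ p)) \<le> (1 / real p) ^ 1"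
    unfolding p_power_dvd_iff[symmetric] by blast
  then have "red ((V + Y) ^ p) = red (V ^ p + Y ^ p)"
    by (simp add: red_eq_iff)
  moreover have "V + Y \<in> carrier OK" "V ^ p \<in> carrier OK" "Y ^ p \<in> carrier OK"
    using V Y OK.add.m_closed[of V Y] OK.nat_pow_closed[of V p] OK.nat_pow_closed[of Y p] by simp_all
  ultimately show ?thesis
    using V Y red.hom_add[of V Y] red.hom_add[of "V ^ p" "Y ^ p"] red_power[of "V + Y" p]
    by (simp add: red_power)
qed

lemma frobenius_uminus:
  assumes "x \<in> carrier Q"
  shows "(\<ominus>\<^bsub>Q\<^esub> x) [^]\<^bsub>Q\<^esub> p = \<ominus>\<^bsub>Q\<^esub> (x [^]\<^bsub>Q\<^esub> p)"
proof -
  have "(\<ominus>\<^bsub>Q\<^esub> x) [^]\<^bsub>Q\<^esub> p \<oplus>\<^bsub>Q\<^esub> x [^]\<^bsub>Q\<^esub> p = (\<ominus>\<^bsub>Q\<^esub> x \<oplus>\<^bsub>Q\<^esub> x) [^]\<^bsub>Q\<^esub> p"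
    using assms by (simp only: frobenius_add Q.a_inv_closed)
  also have "\<dots> = \<zero>\<^bsub>Q\<^esub>"
    using assms p_pos by (simp add: Q.l_neg Q.nat_pow_zero)
  finally show ?thesis
    using assms by (intro Q.minus_equality[symmetric]) auto
qed

abbreviation Fl :: "(nat \<Rightarrow> 'k set) ring"
  where "Fl \<equiv> OK_flat p"

lemma carrier_Fl: "x \<in> carrier Fl \<longleftrightarrow> (\<forall>n. x n \<in> carrier Q \<and> x (Suc n) [^]\<^bsub>Q\<^esub> p = x n)"
  and mult_Fl: "x \<otimes>\<^bsub>Fl\<^esub> y = (\<lambda>n. x n \<otimes>\<^bsub>Q\<^esub> y n)"
  and add_Fl: "x \<oplus>\<^bsub>Fl\<^esub> y = (\<lambda>n. x n \<oplus>\<^bsub>Q\<^esub> y n)"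
  and one_Fl: "\<one>\<^bsub>Fl\<^esub> = (\<lambda>n. \<one>\<^bsub>Q\<^esub>)"
  and zero_Fl: "\<zero>\<^bsub>Fl\<^esub> = (\<lambda>n. \<zero>\<^bsub>Q\<^esub>)"
  by (auto simp: OK_flat_def frob_limit_def)

lemma cring_Fl: "cring Fl"
proof (rule cringI)
  show "abelian_group Fl"
  proof (rule abelian_groupI)
    fix x assume x: "x \<in> carrier Fl"
    then have "(\<lambda>n. \<ominus>\<^bsub>Q\<^esub> x n) \<in> carrier Fl"
      by (auto simp: carrier_Fl frobenius_uminus)
    with x show "\<exists>y\<in>carrier Fl. y \<oplus>\<^bsub>Fl\<^esub> x = \<zero>\<^bsub>Fl\<^esub>"
      by (intro bexI[of _ "\<lambda>n. \<ominus>\<^bsub>Q\<^esub> x n"]) (auto simp: add_Fl zero_Fl carrier_Fl Q.l_neg)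
  qed (use p_pos in \<open>auto simp: carrier_Fl add_Fl zero_Fl frobenius_add Q.a_ac Q.nat_pow_zero\<close>)
  show "Group.comm_monoid Fl"
    by (rule Group.comm_monoidI)
      (auto simp: carrier_Fl mult_Fl one_Fl Q.nat_pow_distrib Q.m_ac)
qed (auto simp: carrier_Fl mult_Fl add_Fl Q.l_distr)

interpretation Fl: cring Fl by (rule cring_Fl)

lemma ring_hom_Fl_component: "ring_hom_cring Fl Q (\<lambda>x. x n)"
  by (intro ring_hom_cring.intro ring_hom_cring_axioms.intro cring_Fl cring_Q)
    (auto simp: ring_hom_def carrier_Fl mult_Fl add_Fl one_Fl)

lemma poly_eval_Fl_component:
  assumes "\<And>v. a v \<in> carrier Fl" "\<And>v. b v \<in> carrier OK" "\<And>v. a v n = red (b v)"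
  shows "poly_eval Fl a F n = red (ev b F)"
  using ring_hom_cring.hom_poly_eval[OF ring_hom_Fl_component[of n], of a F] assms
  by (simp add: red_poly_eval)

section \<open>Witt vectors over the tilt\<close>

abbreviation W :: "(nat \<Rightarrow> nat \<Rightarrow> 'k set) ring"
  where "W \<equiv> Ainf p"

lemma carrier_W: "x \<in> carrier W \<longleftrightarrow> (\<forall>i. x i \<in> carrier Fl)"
  and mult_W: "x \<otimes>\<^bsub>W\<^esub> y = (\<lambda>i. poly_eval Fl (case_sum x y) (witt_prod p i))"
  and add_W: "x \<oplus>\<^bsub>W\<^esub> y = (\<lambda>i. poly_eval Fl (case_sum x y) (witt_sum p i))"
  and one_W: "\<one>\<^bsub>W\<^esub> = teich Fl \<one>\<^bsub>Fl\<^esub>"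
  and zero_W: "\<zero>\<^bsub>W\<^esub> = (\<lambda>i. \<zero>\<^bsub>Fl\<^esub>)"
  by (auto simp: Ainf_def witt_ring_def)

text \<open>The image of \<open>x\<close> in \<open>W(\<O>\<^sub>K/p)\<close> at level \<open>n\<close> of the tilt is lifted by \<open>V\<close> to \<open>W(\<O>\<^sub>K)\<close>.\<close>

definition lifts :: "nat \<Rightarrow> (nat \<Rightarrow> 'k) \<Rightarrow> (nat \<Rightarrow> nat \<Rightarrow> 'k set) \<Rightarrow> bool"
  where "lifts n V x \<longleftrightarrow> (\<forall>i. V i \<in> carrier OK \<and> x i n = red (V i))"

lemma lifts_exists:
  assumes "x \<in> carrier W"
  obtains V where "lifts n V x"
proof -
  have "\<exists>y. y \<in> carrier OK \<and> x i n = red y" for i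
  proof -
    have "x i n \<in> carrier Q" using assms by (simp add: carrier_W carrier_Fl)
    then show ?thesis by (rule Q_cases) auto
  qed
  then show ?thesis using that unfolding lifts_def by metis
qed

text \<open>An element is determined by its images at all levels, and two images agree once they
  have a common lift. Identities can thus be checked on lifts, where the ghost components determine
  the entries.\<close>

lemma W_eqI:
  assumes "\<And>n. \<exists>V. lifts n V x \<and> lifts n V y"
  shows "x = y"
  using assms unfolding lifts_def by (intro ext) metis

lemma carrier_W_case_sum:
  "x \<in> carrier W \<Longrightarrow> y \<in> carrier W \<Longrightarrow> case_sum x y v \<in> carrier Fl"
  by (auto simp: carrier_W split: sum.split)

lemma poly_eval_W_closed:
  assumes "x \<in> carrier W" "y \<in> carrier W"
  shows "(\<lambda>i. poly_eval Fl (case_sum x y) (F i)) \<in> carrier W"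
  unfolding carrier_W[of "\<lambda>i. _ i"] using Fl.poly_eval_closed[OF carrier_W_case_sum[OF assms]] by simp

text \<open>Integral polynomials commute with the projection to level \<open>n\<close> and with the
  reduction of lifts.\<close>

lemma lifts_poly_eval:
  assumes "x \<in> carrier W" "y \<in> carrier W" "lifts n V x" "lifts n Y y"
  shows "lifts n (\<lambda>i. ev (case_sum V Y) (F i)) (\<lambda>i. poly_eval Fl (case_sum x y) (F i))"
proof -
  have VY: "case_sum V Y v \<in> carrier OK" "case_sum x y v n = red (case_sum V Y v)" for v
    using assms(3,4) by (auto simp: lifts_def split: sum.split)
  show ?thesis
    unfolding lifts_def
    using ev_mem_OK[OF VY(1)] poly_eval_Fl_component[OF carrier_W_case_sum[OF assms(1,2)] VY] by simp
qed

lemma lifts_add: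
  assumes "x \<in> carrier W" "y \<in> carrier W" "lifts n V x" "lifts n Y y"
  shows "lifts n (witt_add p V Y) (x \<oplus>\<^bsub>W\<^esub> y)"
  using lifts_poly_eval[OF assms, of "witt_sum p"] by (simp add: add_W witt_add_def[abs_def])

lemma lifts_mult:
  assumes "x \<in> carrier W" "y \<in> carrier W" "lifts n V x" "lifts n Y y"
  shows "lifts n (witt_mult p V Y) (x \<otimes>\<^bsub>W\<^esub> y)"
  using lifts_poly_eval[OF assms, of "witt_prod p"] by (simp add: mult_W witt_mult_def[abs_def])

lemma lifts_teich:
  assumes "a n = red b" "b \<in> carrier OK"
  shows "lifts n (witt_teich b) (teich Fl a)"
  using assms red.hom_zero by (auto simp: lifts_def witt_teich_def teich_def zero_Fl mem_OK)

lemma lifts_one: "lifts n (witt_teich 1) \<one>\<^bsub>W\<^esub>"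
  using red.hom_one by (auto simp: one_W one_Fl mem_OK intro!: lifts_teich)

lemma lifts_zero: "lifts n (\<lambda>_. 0) \<zero>\<^bsub>W\<^esub>"
  using red.hom_zero by (auto simp: lifts_def zero_W zero_Fl mem_OK)

lemma add_W_closed: "x \<in> carrier W \<Longrightarrow> y \<in> carrier W \<Longrightarrow> x \<oplus>\<^bsub>W\<^esub> y \<in> carrier W"
  unfolding add_W by (rule poly_eval_W_closed)

lemma teich_closed: "a \<in> carrier Fl \<Longrightarrow> teich Fl a \<in> carrier W"
  by (auto simp: carrier_W teich_def)

lemma one_W_closed: "\<one>\<^bsub>W\<^esub> \<in> carrier W"
  by (auto simp: one_W intro: teich_closed)

lemma zero_W_closed: "\<zero>\<^bsub>W\<^esub> \<in> carrier W"
  by (auto simp: carrier_W zero_W)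

lemma witt_eqI:
  assumes "\<And>n. ghost_comp p V n = ghost_comp p (Y :: nat \<Rightarrow> 'k) n"
  shows "V = Y"
proof
  fix i
  have cancel: "a = b" if "of_nat p ^ n * a = of_nat p ^ n * b" for n and a b :: 'k
    using that p_pos by simp
  show "V i = Y i"
    by (rule ghost_comp_inject[where p = p and N = i, OF cancel]) (simp_all add: assms)
qed

lemma ghost_comp_zero: "ghost_comp p (\<lambda>_. 0 :: 'k) n = 0"
  using p_pos by (auto simp: ghost_comp_def zero_power)

text \<open>Provides an explicit inverse with a known lift; by uniqueness of inverses it is the one
  hidden in the record subtraction.\<close>

lemma uminus_W:
  assumes "x \<in> carrier W"
  defines "y \<equiv> \<lambda>i. poly_eval Fl (case_sum x x) (witt_neg p i)"
  shows "y \<in> carrier W" "y \<oplus>\<^bsub>W\<^esub> x = \<zero>\<^bsub>W\<^esub>"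
    "\<And>n V. lifts n V x \<Longrightarrow> lifts n (witt_uminus p V) y"
proof -
  show y: "y \<in> carrier W"
    unfolding y_def by (rule poly_eval_W_closed[OF assms(1,1)])
  show lifts: "lifts n (witt_uminus p V) y" if "lifts n V x" for n V
    using lifts_poly_eval[OF assms(1,1) that that, of "witt_neg p"]
    by (simp add: y_def witt_uminus_def[abs_def])
  show "y \<oplus>\<^bsub>W\<^esub> x = \<zero>\<^bsub>W\<^esub>"
  proof (rule W_eqI)
    fix n
    obtain V where V: "lifts n V x" using lifts_exists[OF assms(1)] .
    have "witt_add p (witt_uminus p V) V = (\<lambda>_. 0)"
      by (rule witt_eqI)
        (simp add: ghost_comp_witt_add ghost_comp_witt_uminus prime_p ghost_comp_zero)
    with lifts_add[OF y assms(1) lifts[OF V] V] lifts_zero[of n]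
    show "\<exists>V. lifts n V (y \<oplus>\<^bsub>W\<^esub> x) \<and> lifts n V \<zero>\<^bsub>W\<^esub>" by auto
  qed
qed

text \<open>Gives the subtraction and the multiple of one in the theorem their usual properties.
  Each law is verified on lifts by comparing ghost components.\<close>

lemma abelian_group_W: "abelian_group W"
proof (rule abelian_groupI)
  fix x y z assume x: "x \<in> carrier W" and y: "y \<in> carrier W" and z: "z \<in> carrier W"
  show "x \<oplus>\<^bsub>W\<^esub> y \<in> carrier W" using x y by (rule add_W_closed)
  show "x \<oplus>\<^bsub>W\<^esub> y \<oplus>\<^bsub>W\<^esub> z = x \<oplus>\<^bsub>W\<^esub> (y \<oplus>\<^bsub>W\<^esub> z)"
  proof (rule W_eqI)
    fix n
    obtain V Y Z where V: "lifts n V x" and Y: "lifts n Y y" and Z: "lifts n Z z"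
      using lifts_exists[OF x] lifts_exists[OF y] lifts_exists[OF z] by metis
    have "witt_add p (witt_add p V Y) Z = witt_add p V (witt_add p Y Z)"
      by (rule witt_eqI) (simp add: ghost_comp_witt_add prime_p)
    with lifts_add[OF add_W_closed[OF x y] z lifts_add[OF x y V Y] Z]
      lifts_add[OF x add_W_closed[OF y z] V lifts_add[OF y z Y Z]]
    show "\<exists>V. lifts n V (x \<oplus>\<^bsub>W\<^esub> y \<oplus>\<^bsub>W\<^esub> z) \<and> lifts n V (x \<oplus>\<^bsub>W\<^esub> (y \<oplus>\<^bsub>W\<^esub> z))"
      by auto
  qed
  show "x \<oplus>\<^bsub>W\<^esub> y = y \<oplus>\<^bsub>W\<^esub> x"
  proof (rule W_eqI)
    fix n
    obtain V Y where V: "lifts n V x" and Y: "lifts n Y y"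
      using lifts_exists[OF x] lifts_exists[OF y] by metis
    have "witt_add p V Y = witt_add p Y V"
      by (rule witt_eqI) (simp add: ghost_comp_witt_add prime_p)
    with lifts_add[OF x y V Y] lifts_add[OF y x Y V]
    show "\<exists>V. lifts n V (x \<oplus>\<^bsub>W\<^esub> y) \<and> lifts n V (y \<oplus>\<^bsub>W\<^esub> x)" by auto
  qed
  show "\<zero>\<^bsub>W\<^esub> \<oplus>\<^bsub>W\<^esub> x = x"
  proof (rule W_eqI)
    fix n
    obtain V where V: "lifts n V x" using lifts_exists[OF x] .
    have "witt_add p (\<lambda>_. 0) V = V"
      by (rule witt_eqI) (simp add: ghost_comp_witt_add prime_p ghost_comp_zero)
    with lifts_add[OF zero_W_closed x lifts_zero V] V
    show "\<exists>V. lifts n V (\<zero>\<^bsub>W\<^esub> \<oplus>\<^bsub>W\<^esub> x) \<and> lifts n V x" by auto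
  qed
  show "\<exists>y\<in>carrier W. y \<oplus>\<^bsub>W\<^esub> x = \<zero>\<^bsub>W\<^esub>" using uminus_W(1,2)[OF x] by blast
qed (rule zero_W_closed)

interpretation W: abelian_group W by (rule abelian_group_W)

lemma lifts_minus:
  assumes x: "x \<in> carrier W" and y: "y \<in> carrier W" and "lifts n V x" "lifts n Y y"
  shows "lifts n (witt_add p V (witt_uminus p Y)) (x \<ominus>\<^bsub>W\<^esub> y)"
  using lifts_add[OF x uminus_W(1)[OF y] assms(3) uminus_W(3)[OF y assms(4)]]
    W.minus_equality[OF uminus_W(2)[OF y] y uminus_W(1)[OF y]]
  by (simp add: a_minus_def)

lemma add_pow_W_closed: "x \<in> carrier W \<Longrightarrow> [k] \<cdot>\<^bsub>W\<^esub> x \<in> carrier W" for k :: nat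
  by (rule W.add.nat_pow_closed)

lemma minus_W_closed: "x \<in> carrier W \<Longrightarrow> y \<in> carrier W \<Longrightarrow> x \<ominus>\<^bsub>W\<^esub> y \<in> carrier W"
  by (rule W.minus_closed)

text \<open>The lift of a multiple is iterated Witt vector addition starting at zero, as opposed to
  multiplying the entries by \<open>k\<close>.\<close>

lemma lifts_add_pow:
  assumes x: "x \<in> carrier W" and V: "lifts n V x"
  shows "lifts n ((witt_add p V ^^ k) (\<lambda>_. 0)) ([k] \<cdot>\<^bsub>W\<^esub> x)"
proof (induction k)
  case 0
  show ?case using lifts_zero by (simp add: add_pow_def nat_pow_def)
next
  case (Suc k)
  have "[Suc k] \<cdot>\<^bsub>W\<^esub> x = x \<oplus>\<^bsub>W\<^esub> [k] \<cdot>\<^bsub>W\<^esub> x"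
    using W.add.nat_pow_Suc2[OF x] by simp
  with lifts_add[OF x add_pow_W_closed[OF x] V Suc] show ?case by simp
qed

end


section \<open>Fontaine's map\<close>

context gauss_tower
begin

section \<open>Ultrametric estimates and limits\<close>

lemma absval_sum_le:
  assumes "\<And>i. i \<in> I \<Longrightarrow> absval (f i :: 'k) \<le> e" "0 \<le> e"
  shows "absval (sum f I) \<le> e"
  using assms(1)
proof (induction I rule: infinite_finite_induct)
  case (insert i I)
  then show ?case using absval_add[of "f i" "sum f I"] by fastforce
qed (simp_all add: assms(2))

text \<open>Divisibility in the field itself is vacuous, so the congruence is proved for integral
  polynomials and evaluated in \<open>OK\<close>; \<open>ev_mem_OK\<close> keeps the cofactor
  integral.\<close>

lemma absval_power_diff_le:
  assumes "a \<in> carrier (OK :: 'k ring)" "b \<in> carrier OK" "absval (a - b) \<le> 1 / real p"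
  shows "absval (a ^ (p ^ m) - b ^ (p ^ m)) \<le> (1 / real p) ^ Suc m"
proof -
  obtain c where c: "c \<in> carrier OK" "a - b = of_nat p * c"
    using p_power_dvd_iff[of "a - b" 1] assms(3) by auto
  let ?y = "pvar (Inl 0)" and ?c = "pvar (Inr 0)" and ?b = "case_sum (\<lambda>_. b) (\<lambda>_. c)"
  have "of_nat p ^ Suc m dvd (?y + of_nat p * ?c) ^ (p ^ m) - ?y ^ (p ^ m)"
    by (rule dvd_power_diff_power_power) simp
  then obtain H where "(?y + of_nat p * ?c) ^ (p ^ m) - ?y ^ (p ^ m) = of_nat p ^ Suc m * H"
    by (rule dvdE)
  from arg_cong[OF this, of "ev ?b"]
  have "(b + of_nat p * c) ^ (p ^ m) - b ^ (p ^ m) = of_nat p ^ Suc m * ev ?b H"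
    by simp
  moreover have "b + of_nat p * c = a"
    unfolding c(2)[symmetric] by simp
  moreover have "ev ?b H \<in> carrier OK"
    by (rule ev_mem_OK) (use assms c in \<open>auto split: sum.split\<close>)
  ultimately show ?thesis unfolding p_power_dvd_iff[symmetric] by auto
qed

lemma power_p_le: "m \<le> n \<Longrightarrow> (1 / real p) ^ n \<le> (1 / real p) ^ m"
  using p_gt_1 by (intro power_decreasing) auto

text \<open>By the ultrametric inequality all later terms differ from \<open>f m\<close> by at most
  the bound on step \<open>m\<close>; this yields the Cauchy property and, in the limit, the error
  estimate.\<close>

lemma limit_exists:
  assumes "\<And>k. absval (f (Suc k) - f k :: 'k) \<le> (1 / real p) ^ k"
  obtains L where "f \<longlonglongrightarrow> L" "\<And>m. absval (L - f m) \<le> (1 / real p) ^ m"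
proof -
  have diff: "absval (f (m + k) - f m) \<le> (1 / real p) ^ m" for m k
  proof (induction k)
    case (Suc k)
    have "absval (f (Suc (m + k)) - f (m + k)) \<le> (1 / real p) ^ m"
      using assms[of "m + k"] power_p_le[of m "m + k"] by linarith
    with Suc show ?case
      using absval_diff_trans[of "f (Suc (m + k))" "f m" "f (m + k)"] by simp
  qed simp
  have "Cauchy f"
  proof (rule metric_CauchyI)
    fix e :: real assume "e > 0"
    moreover have "(\<lambda>m. (1 / real p) ^ m) \<longlonglongrightarrow> 0"
      using p_gt_1 by (intro LIMSEQ_realpow_zero) auto
    ultimately obtain M where M: "(1 / real p) ^ M < e"
      by (metis LIMSEQ_D dual_order.refl diff_zero real_norm_def abs_less_iff)
    have dist_M: "absval (f m - f M) \<le> (1 / real p) ^ M" if "m \<ge> M" for m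
      using diff[of M "m - M"] that by simp
    have "dist (f m) (f n) < e" if "m \<ge> M" "n \<ge> M" for m n
      using absval_diff_trans[of "f m" "f n" "f M"] dist_M[OF that(1)] dist_M[OF that(2)] M
        absval_uminus[of "f n - f M"] by (simp add: dist_absval)
    then show "\<exists>M. \<forall>m\<ge>M. \<forall>n\<ge>M. dist (f m) (f n) < e" by blast
  qed
  then obtain L where L: "f \<longlonglongrightarrow> L"
    using Cauchy_convergent_iff convergent_def by blast
  have "absval (L - f m) \<le> (1 / real p) ^ m" for m
  proof -
    have "(\<lambda>k. f (m + k)) \<longlonglongrightarrow> L"
      using LIMSEQ_ignore_initial_segment[OF L, of m] by (simp add: add.commute)
    then have "(\<lambda>k. dist (f (m + k)) (f m)) \<longlonglongrightarrow> dist L (f m)"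
      by (intro tendsto_dist tendsto_const)
    then have "dist L (f m) \<le> (1 / real p) ^ m"
      by (rule LIMSEQ_le_const2) (use diff in \<open>auto simp: dist_absval\<close>)
    then show ?thesis by (simp add: dist_absval)
  qed
  with L show ?thesis by (rule that)
qed

text \<open>The \<open>p\<close>-th power of a lift at level \<open>Suc k\<close> is congruent to a
  lift at level \<open>k\<close> modulo \<open>p\<close>, and raising to the power
  \<open>p ^ k\<close> sharpens the congruence. The same estimate compares the limit with any other
  lift \<open>a\<close>.\<close>

lemma sharp_approx:
  assumes x: "x \<in> carrier Fl" and a: "a \<in> carrier OK" "x n = red a" and "i \<le> n"
  shows "absval (sharp p i x - a ^ (p ^ (n - i))) \<le> (1 / real p) ^ (n - i)"
    and "sharp p i x \<in> carrier OK"
proof -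
  define s where "s k = (SOME y. y \<in> x k)" for k
  have s: "s k \<in> carrier OK" "x k = red (s k)" for k
  proof -
    have "x k \<in> carrier Q" using x by (simp add: carrier_Fl)
    then obtain y where y: "y \<in> carrier OK" "x k = red y" by (rule Q_cases)
    then have "y \<in> x k" by (simp add: red_eq)
    then have "s k \<in> x k" unfolding s_def by (rule someI)
    then have le: "absval (s k - y) \<le> 1 / real p" by (simp add: y red_eq)
    then show "x k = red (s k)" using y red_eq_iff[of "s k" y] by simp
    have "1 / real p \<le> 1" using p_pos by simp
    then show "s k \<in> carrier OK"
      using le y(1) absval_add[of "s k - y" y] by (simp add: mem_OK)
  qed
  have s_Suc: "absval (s (Suc k) ^ p - s k) \<le> 1 / real p" for k
  proof -
    have "red (s (Suc k) ^ p) = red (s k)"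
      using x s by (metis carrier_Fl red_power)
    then show ?thesis by (simp add: red_eq_iff)
  qed
  have s_power: "s k ^ m \<in> carrier OK" for k m
    using s(1)[of k] by (auto simp: mem_OK absval_power power_le_one)
  \<comment> \<open>The shift by \<open>i\<close> discards the indices below \<open>i\<close>, where
    the exponent in \<open>sharp\<close> is truncated.\<close>
  define f where "f k = s (k + i) ^ (p ^ k)" for k
  have "absval (f (Suc k) - f k) \<le> (1 / real p) ^ k" for k
  proof -
    have "absval ((s (Suc (k + i)) ^ p) ^ (p ^ k) - s (k + i) ^ (p ^ k)) \<le> (1 / real p) ^ Suc k"
      by (intro absval_power_diff_le s_power s s_Suc)
    then show ?thesis
      using power_p_le[of k "Suc k"] unfolding f_def power_mult[symmetric] power_Suc[of p]
      by (simp del: power_Suc)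
  qed
  then obtain L where L: "f \<longlonglongrightarrow> L" "\<And>m. absval (L - f m) \<le> (1 / real p) ^ m"
    using limit_exists by blast
  have "(\<lambda>k. s (k + i) ^ (p ^ (k + i - i))) \<longlonglongrightarrow> L"
    using L(1) by (simp add: f_def[abs_def])
  then have "(\<lambda>k. s k ^ (p ^ (k - i))) \<longlonglongrightarrow> L"
    by (rule LIMSEQ_offset[where k = i])
  then have sharp: "sharp p i x = L"
    unfolding sharp_def s_def[symmetric] by (rule limI)
  show "sharp p i x \<in> carrier OK"
    using L(2)[of 0] s_power[of i 1] absval_add[of "L - f 0" "f 0"] sharp by (simp add: mem_OK f_def)
  have "absval (s n - a) \<le> 1 / real p"
    using s(2)[of n] a(2) red_eq_iff[of "s n" a] by simp
  from absval_power_diff_le[OF s(1) a(1) this, of "n - i"]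
  have "absval (f (n - i) - a ^ (p ^ (n - i))) \<le> (1 / real p) ^ (n - i)"
    using \<open>i \<le> n\<close> power_p_le[of "n - i" "Suc (n - i)"] by (simp add: f_def del: power_Suc)
  with L(2)[of "n - i"] show "absval (sharp p i x - a ^ (p ^ (n - i))) \<le> (1 / real p) ^ (n - i)"
    using absval_diff_trans[of L "a ^ (p ^ (n - i))" "f (n - i)"] unfolding sharp by linarith
qed

text \<open>For \<open>i < n\<close> the \<open>i\<close>-th terms differ by at most
  \<open>p ^ i\<close> times the error \<open>p ^ (n - i)\<close> of \<open>sharp_approx\<close>, in
  absolute value; the tail of the series and the last ghost term are themselves divisible by
  \<open>p ^ n\<close>.\<close>

lemma theta_approx:
  assumes x: "x \<in> carrier W" and V: "lifts n V x"
  shows "absval (theta p x - ghost_comp p V n) \<le> (1 / real p) ^ n"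
proof -
  have xi: "x i \<in> carrier Fl" for i using x by (simp add: carrier_W)
  have Vi: "V i \<in> carrier OK" "x i n = red (V i)" for i using V by (auto simp: lifts_def)
  have sharp_OK: "sharp p i (x i) \<in> carrier OK" for i
  proof -
    obtain U where "lifts i U x" using lifts_exists[OF x] .
    then show ?thesis using sharp_approx(2)[OF xi, of "U i" i i i] by (simp add: lifts_def)
  qed
  define f where "f k = (\<Sum>i<k. of_nat p ^ i * sharp p i (x i))" for k
  have "absval (f (Suc k) - f k) \<le> (1 / real p) ^ k" for k
  proof -
    have "f (Suc k) - f k = of_nat p ^ k * sharp p k (x k)" by (simp add: f_def)
    then show ?thesis using sharp_OK unfolding p_power_dvd_iff[symmetric] by blast
  qed
  then obtain L where L: "f \<longlonglongrightarrow> L" "\<And>m. absval (L - f m) \<le> (1 / real p) ^ m"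
    using limit_exists by blast
  have "(\<lambda>i. of_nat p ^ i * sharp p i (x i)) sums L"
    using L(1) by (simp add: sums_def f_def[abs_def])
  then have theta: "theta p x = L"
    unfolding theta_def by (rule sums_unique[symmetric])
  have "ghost_comp p V n = (\<Sum>i<n. of_nat p ^ i * V i ^ (p ^ (n - i))) + of_nat p ^ n * V n"
    by (simp add: ghost_comp_def flip: lessThan_Suc_atMost)
  then have split: "f n - ghost_comp p V n
      = (\<Sum>i<n. of_nat p ^ i * (sharp p i (x i) - V i ^ (p ^ (n - i)))) - of_nat p ^ n * V n"
    by (simp add: f_def right_diff_distrib sum_subtractf)
  have "absval (\<Sum>i<n. of_nat p ^ i * (sharp p i (x i) - V i ^ (p ^ (n - i)))) \<le> (1 / real p) ^ n"
  proof (rule absval_sum_le)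
    fix i assume "i \<in> {..<n}"
    then have i: "i \<le> n" by simp
    have "absval (of_nat p ^ i * (sharp p i (x i) - V i ^ (p ^ (n - i))))
      \<le> (1 / real p) ^ i * (1 / real p) ^ (n - i)"
      unfolding absval_mult absval_p_power
      by (intro mult_left_mono sharp_approx(1)[OF xi Vi i]) simp
    then show "absval (of_nat p ^ i * (sharp p i (x i) - V i ^ (p ^ (n - i)))) \<le> (1 / real p) ^ n"
      using i unfolding power_add[symmetric] by simp
  qed simp
  moreover have "absval (of_nat p ^ n * V n) \<le> (1 / real p) ^ n"
    using Vi(1) unfolding p_power_dvd_iff[symmetric] by blast
  ultimately have "absval (f n - ghost_comp p V n) \<le> (1 / real p) ^ n"
    unfolding split by (intro order_trans[OF absval_diff]) simp
  with L(2)[of n] show ?thesis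
    using absval_diff_trans[of L "ghost_comp p V n" "f n"] unfolding theta by linarith
qed

text \<open>By density every entry has an element of \<open>K0bar\<close> within
  \<open>1 / p\<close>, which has the same reduction and is integral. Entries in \<open>OB\<close>
  are wanted because their differentials are available.\<close>

lemma lifts_exists_OB:
  assumes x: "x \<in> carrier W"
  obtains V where "lifts n V x" "\<And>i. V i \<in> OB"
proof -
  obtain U where U: "lifts n U x" using lifts_exists[OF x] .
  have "\<exists>b. b \<in> OB \<and> red b = red (U i)" for i
  proof -
    have "U i \<in> closure K0bar" using K0bar_dense by simp
    moreover have "0 < 1 / real p" using p_pos by simp
    ultimately obtain b where b: "b \<in> K0bar" "dist b (U i) < 1 / real p"
      unfolding closure_approachable by blast
    then have le: "absval (b - U i) \<le> 1 / real p" by (simp add: dist_absval)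
    moreover have "1 / real p \<le> 1" using p_pos by simp
    moreover have "absval (U i) \<le> 1" using U by (simp add: lifts_def mem_OK)
    ultimately have "absval b \<le> 1"
      using absval_add[of "b - U i" "U i"] unfolding diff_add_cancel by linarith
    with b(1) le show ?thesis by (auto simp: carrier_val_ring red_eq_iff)
  qed
  then obtain V where V: "\<And>i. V i \<in> OB" "\<And>i. red (V i) = red (U i)" by metis
  with U have "lifts n V x" by (auto simp: lifts_def OB_subset_OK)
  then show ?thesis using V(1) by (rule that)
qed

section \<open>Witt vectors with entries in \<open>OB\<close>\<close>

lemma witt_ops_OB:
  assumes "\<And>i. V i \<in> OB" "\<And>i. Y i \<in> OB"
  shows "witt_add p V Y i \<in> OB" "witt_mult p V Y i \<in> OB"
  using assms unfolding witt_add_def witt_mult_def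
  by (auto intro!: kaehler.ev_closed split: sum.split)

lemma witt_uminus_OB: "(\<And>i. V i \<in> OB) \<Longrightarrow> witt_uminus p V i \<in> OB"
  unfolding witt_uminus_def by (auto intro!: kaehler.ev_closed split: sum.split)

lemma witt_teich_OB: "a \<in> OB \<Longrightarrow> witt_teich a i \<in> OB"
  by (simp add: witt_teich_def OB_0)

lemma witt_multiple_OB:
  assumes "\<And>i. V i \<in> OB"
  shows "(witt_add p V ^^ k) (\<lambda>_. 0) i \<in> OB"
  using assms by (induction k arbitrary: i) (auto intro: OB_0 witt_ops_OB)

lemma ghost_comp_witt_multiple:
  "ghost_comp p ((witt_add p V ^^ k) (\<lambda>_. 0)) n = of_nat k * ghost_comp p (V :: nat \<Rightarrow> 'k) n"
  by (induction k) (simp_all add: ghost_comp_zero ghost_comp_witt_add prime_p algebra_simps)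

lemma delta_witt_one: "kaehler.cong_N (kaehler.delta p n (witt_teich 1)) 0"
  using kaehler.cong_N_trans[OF kaehler.delta_witt_teich[OF prime_p, of n 1]] kaehler.D_1
  by simp

text \<open>An integer is a sum of ones, \<open>delta\<close> is additive, and it kills one; the
  zero vector is treated as the Teichmueller vector of 0.\<close>

lemma delta_witt_multiple_one:
  "kaehler.cong_N (kaehler.delta p n ((witt_add p (witt_teich 1) ^^ k) (\<lambda>_. 0))) 0"
proof (induction k)
  case 0
  have teich_0: "witt_teich 0 = (\<lambda>_. 0 :: 'k)" by (auto simp: witt_teich_def)
  have "kaehler.cong_N (fscale (0 ^ (p ^ n - 1)) (differential 0)) 0"
    using kaehler.cong_N_scale[OF kaehler.power_closed[OF OB_0] kaehler.D_0] unfolding kaehler.scale_zero_right .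
  from kaehler.cong_N_trans[OF kaehler.delta_witt_teich[OF prime_p] this] show ?case
    unfolding teich_0 funpow.simps id_apply .
next
  case (Suc k)
  let ?V = "(witt_add p (witt_teich 1) ^^ k) (\<lambda>_. 0)"
  have "kaehler.cong_N (kaehler.delta p n (witt_add p (witt_teich 1) ?V))
    (kaehler.delta p n (witt_teich 1) + kaehler.delta p n ?V)"
    by (intro kaehler.delta_witt_add prime_p witt_multiple_OB witt_teich_OB OB_1)
  also have "kaehler.cong_N \<dots> (0 + 0)"
    by (intro kaehler.cong_N_add delta_witt_one Suc)
  finally show ?case unfolding funpow.simps comp_apply add_0_left .
qed

section \<open>Root systems and logarithmic differentials\<close>

lemma root_system_OB: "root_system p K0bar a r \<Longrightarrow> r n \<in> OB"
  by (simp add: root_system_def)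

lemma root_system_power: "root_system p K0bar a r \<Longrightarrow> r n ^ (p ^ n) = a"
  by (induction n) (auto simp: root_system_def power_mult)

lemma flat_mem_Fl:
  assumes "root_system p K0bar a r"
  shows "flat p r \<in> carrier Fl"
proof -
  have "r n \<in> carrier OK" "r (Suc n) ^ p = r n" for n
    using assms by (auto simp: root_system_def carrier_val_ring)
  then show ?thesis
    using ring_hom_closed[OF ring_hom_cring.homh[OF ring_hom_red]]
    by (auto simp: carrier_Fl flat_def red_power simp flip: red_def)
qed

lemma lifts_teich_flat:
  assumes "root_system p K0bar a r"
  shows "lifts n (witt_teich (r n)) (teich Fl (flat p r))"
  by (intro lifts_teich OB_subset_OK root_system_OB[OF assms]) (simp add: flat_def red_def)

text \<open>Formally \<open>x ^ (p ^ n)\<close> times \<open>dx / x\<close>; at a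
  \<open>p ^ n\<close>-th root this represents component \<open>n\<close> of
  \<open>d_theta\<close>.\<close>

definition dlog :: "nat \<Rightarrow> 'k \<Rightarrow> 'k \<Rightarrow> 'k"
  where "dlog n x = fscale (x ^ (p ^ n - 1)) (differential x)"

lemma dlog_relation:
  assumes rp: "root_system p K0bar (of_nat p) rp"
    and rT: "root_system p K0bar T rT"
    and rU: "root_system p K0bar (1 - T) rU"
    and A: "A \<in> carrier W"
    and eq: "teich Fl (flat p rT) \<oplus>\<^bsub>W\<^esub> teich Fl (flat p rU) \<ominus>\<^bsub>W\<^esub> \<one>\<^bsub>W\<^esub>
       = A \<otimes>\<^bsub>W\<^esub> (teich Fl (flat p rp) \<ominus>\<^bsub>W\<^esub> [p] \<cdot>\<^bsub>W\<^esub> \<one>\<^bsub>W\<^esub>)"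
    and a: "lifts n a A" "\<And>i. a i \<in> OB"
  shows "kaehler.cong_N (dlog n (rT n) + dlog n (rU n)) (fscale (ghost_comp p a n) (dlog n (rp n)))"
proof -
  let ?t = "witt_teich (rT n)" and ?u = "witt_teich (rU n)" and ?pi = "witt_teich (rp n)"
  let ?P = "(witt_add p (witt_teich 1) ^^ p) (\<lambda>_. 0)"
  \<comment> \<open>At level \<open>n\<close>, \<open>x\<close> and \<open>y\<close> lift the two
    sides of the equation, \<open>z\<close> the factor on the right and \<open>?P\<close> the
    integer \<open>p\<close>.\<close>
  define z where "z = witt_add p ?pi (witt_uminus p ?P)"
  define x where "x = witt_add p (witt_add p ?t ?u) (witt_uminus p (witt_teich 1))"
  define y where "y = witt_mult p a z"
  note closed = witt_ops_OB witt_uminus_OB witt_teich_OB witt_multiple_OB OB_1 a(2) root_system_OB[OF rp]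
    root_system_OB[OF rT] root_system_OB[OF rU]
  have z_OB: "z i \<in> OB" for i unfolding z_def by (intro closed)
  have x_OB: "x i \<in> OB" for i unfolding x_def by (intro closed)
  have y_OB: "y i \<in> OB" for i unfolding y_def by (intro closed z_OB)
  note W_closed = teich_closed flat_mem_Fl[OF rp] flat_mem_Fl[OF rT] flat_mem_Fl[OF rU]
    add_W_closed minus_W_closed one_W_closed add_pow_W_closed A
  have "lifts n x (teich Fl (flat p rT) \<oplus>\<^bsub>W\<^esub> teich Fl (flat p rU) \<ominus>\<^bsub>W\<^esub> \<one>\<^bsub>W\<^esub>)"
    unfolding x_def
    by (intro lifts_minus lifts_add lifts_teich_flat[OF rT] lifts_teich_flat[OF rU] lifts_one W_closed)
  moreover have "lifts n y (A \<otimes>\<^bsub>W\<^esub> (teich Fl (flat p rp) \<ominus>\<^bsub>W\<^esub> [p] \<cdot>\<^bsub>W\<^esub> \<one>\<^bsub>W\<^esub>))"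
    unfolding y_def z_def
    by (intro lifts_mult lifts_minus lifts_add_pow lifts_teich_flat[OF rp] lifts_one a(1) W_closed)
  \<comment> \<open>Lifts of the same element have equal reductions; the exponent 1 fits
    \<open>OB_p_power_dvd\<close>.\<close>
  ultimately have le: "absval (x i - y i) \<le> (1 / real p) ^ 1" for i
    using eq unfolding lifts_def by (metis red_eq_iff power_one_right)
  have "\<exists>c. c \<in> OB \<and> x i - y i = of_nat p ^ 1 * c" for i
    proof -
    have "x i - y i \<in> OB" using OB_add[OF x_OB OB_uminus[OF y_OB], of i i] by simp
    then show ?thesis using le by (rule OB_p_power_dvd) auto
  qed
  then obtain c where c: "\<And>i. c i \<in> OB" "\<And>i. x i - y i = of_nat p * c i"
    by (metis power_one_right)
  \<comment> \<open>The Teichmueller vector contributes \<open>rp n ^ (p ^ n) = p\<close>, and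
    \<open>?P\<close> contributes \<open>p\<close> as well.\<close>
  have ghost_z: "ghost_comp p z n = 0"
    using root_system_power[OF rp, of n]
    by (simp add: z_def ghost_comp_witt_add ghost_comp_witt_uminus ghost_comp_witt_teich
      ghost_comp_witt_multiple prime_p p_pos)
  \<comment> \<open>The ghost component is \<open>T + (1 - T) - 1\<close>.\<close>
  have ghost_x: "ghost_comp p x n = 0"
    using root_system_power[OF rT, of n] root_system_power[OF rU, of n]
    by (simp add: x_def ghost_comp_witt_add ghost_comp_witt_uminus ghost_comp_witt_teich prime_p p_pos)
  have uminus_cong_0: "kaehler.cong_N (- w) 0" if "kaehler.cong_N w 0" for w
    using kaehler.N_uminus that by (simp add: kaehler.cong_N_def)
  have "kaehler.cong_N (kaehler.delta p n x) (kaehler.delta p n y)"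
  proof (rule kaehler.delta_cong[OF prime_p y_OB c(1)])
    show "x i = y i + of_nat p * c i" for i using c(2)[of i] by (simp add: algebra_simps)
    show "ghost_comp p x n = ghost_comp p y n"
      by (simp add: y_def ghost_x ghost_z ghost_comp_witt_mult prime_p)
    show "a = 0" if "of_nat p ^ m * a = 0" for a :: 'k and m using that p_pos by simp
  qed
  moreover have "kaehler.cong_N (kaehler.delta p n x) (dlog n (rT n) + dlog n (rU n))"
  proof -
    have "kaehler.cong_N (kaehler.delta p n x)
      (kaehler.delta p n (witt_add p ?t ?u) + kaehler.delta p n (witt_uminus p (witt_teich 1)))"
      unfolding x_def by (intro kaehler.delta_witt_add prime_p closed)
    also have "kaehler.cong_N \<dots>
      ((kaehler.delta p n ?t + kaehler.delta p n ?u) + - kaehler.delta p n (witt_teich 1))"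
      by (intro kaehler.cong_N_add kaehler.delta_witt_add kaehler.delta_witt_uminus prime_p closed)
    also have "kaehler.cong_N \<dots> ((dlog n (rT n) + dlog n (rU n)) + 0)"
      unfolding dlog_def
      by (intro kaehler.cong_N_add kaehler.delta_witt_teich uminus_cong_0 delta_witt_one prime_p)
    finally show ?thesis by simp
  qed
  moreover have "kaehler.cong_N (kaehler.delta p n y) (fscale (ghost_comp p a n) (dlog n (rp n)))"
  proof -
    have "kaehler.cong_N (kaehler.delta p n z) (kaehler.delta p n ?pi + kaehler.delta p n (witt_uminus p ?P))"
      unfolding z_def by (intro kaehler.delta_witt_add prime_p closed)
    also have "kaehler.cong_N \<dots> (dlog n (rp n) + - kaehler.delta p n ?P)"
      unfolding dlog_def
      by (intro kaehler.cong_N_add kaehler.delta_witt_teich kaehler.delta_witt_uminus prime_p closed)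
    also have "kaehler.cong_N \<dots> (dlog n (rp n) + 0)"
      by (intro kaehler.cong_N_add uminus_cong_0 delta_witt_multiple_one kaehler.cong_N_refl)
    finally have delta_z: "kaehler.cong_N (kaehler.delta p n z) (dlog n (rp n))" by simp
    \<comment> \<open>In the Leibniz rule \<open>delta p n a\<close>, of which nothing is known, is
      multiplied by the ghost component of \<open>z\<close>, which is zero.\<close>
    have "kaehler.cong_N (kaehler.delta p n y)
      (fscale (ghost_comp p a n) (kaehler.delta p n z) + fscale (ghost_comp p z n) (kaehler.delta p n a))"
      unfolding y_def by (rule kaehler.delta_witt_mult[OF prime_p a(2) z_OB])
    also have "\<dots> = fscale (ghost_comp p a n) (kaehler.delta p n z)"
      by (simp add: ghost_z)
    also have "kaehler.cong_N \<dots> (fscale (ghost_comp p a n) (dlog n (rp n)))"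
      by (rule kaehler.cong_N_scale[OF kaehler.ghost_comp_closed[OF a(2)] delta_z])
    finally show ?thesis .
  qed
  ultimately show ?thesis
    by (meson kaehler.cong_N_sym kaehler.cong_N_trans)
qed

text \<open>The multiple is the differential of \<open>r n ^ (p ^ n) = p\<close>, and
  \<open>p\<close> lies in the base ring.\<close>

lemma p_power_dlog:
  assumes "root_system p K0bar (of_nat p) r"
  shows "kaehler.cong_N (fscale (of_nat p ^ n) (dlog n (r n))) 0"
proof -
  have "kaehler.cong_N (fscale (of_nat p ^ n) (dlog n (r n))) (differential (r n ^ (p ^ n)))"
    using kaehler.D_power[OF root_system_OB[OF assms], of n "p ^ n", THEN kaehler.cong_N_sym]
    by (simp add: dlog_def)
  then show ?thesis
    unfolding root_system_power[OF assms] using differential_p by (rule kaehler.cong_N_trans)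
qed

text \<open>As \<open>p ^ n\<close> kills \<open>dlog n (r n)\<close>, coefficients count only
  modulo \<open>p ^ n\<close>; this frees the action on the Tate module from the choice of a
  representative.\<close>

lemma dlog_scale_cong:
  assumes r: "root_system p K0bar (of_nat p) r"
    and "a \<in> OB" "b \<in> OB" "absval (a - b) \<le> (1 / real p) ^ n"
  shows "kaehler.cong_N (fscale a (dlog n (r n))) (fscale b (dlog n (r n)))"
proof -
  have "a - b \<in> OB" using OB_add[OF assms(2) OB_uminus[OF assms(3)]] by simp
  then obtain c where c: "c \<in> OB" "a - b = of_nat p ^ n * c"
    using assms(4) by (rule OB_p_power_dvd)
  then have a: "a = b + c * of_nat p ^ n" by (simp add: algebra_simps)
  have "kaehler.cong_N (fscale b (dlog n (r n)) + fscale c (fscale (of_nat p ^ n) (dlog n (r n))))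
    (fscale b (dlog n (r n)) + fscale c 0)"
    by (intro kaehler.cong_N_add kaehler.cong_N_scale p_power_dlog[OF r] c kaehler.cong_N_refl)
  then show ?thesis
    unfolding a kaehler.scale_left_distrib kaehler.scale_scale kaehler.scale_zero_right add_0_right .
qed

end

theorem proposition0p2:
  fixes p :: nat
    and T :: "'k::{field_char_0, complete_space}"
    and K0bar :: "'k set"
    and rp rT rU :: "nat \<Rightarrow> 'k"
    and A :: "nat \<Rightarrow> nat \<Rightarrow> 'k set"
  assumes "gauss_tower p T K0bar"
    and "root_system p K0bar (of_nat p) rp"
    and "root_system p K0bar T rT"
    and "root_system p K0bar (1 - T) rU"
    and "A \<in> carrier (Ainf p)"
    and "teich (OK_flat p) (flat p rT) \<oplus>\<^bsub>Ainf p\<^esub> teich (OK_flat p) (flat p rU) \<ominus>\<^bsub>Ainf p\<^esub> \<one>\<^bsub>Ainf p\<^esub>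
       = A \<otimes>\<^bsub>Ainf p\<^esub> (teich (OK_flat p) (flat p rp) \<ominus>\<^bsub>Ainf p\<^esub> [p] \<cdot>\<^bsub>Ainf p\<^esub> \<one>\<^bsub>Ainf p\<^esub>)"
  shows "d_theta p T K0bar rT \<oplus>\<^bsub>TT p T K0bar\<^esub> d_theta p T K0bar rU
       = theta p A \<odot>\<^bsub>TT p T K0bar\<^esub> d_theta p T K0bar rp"
proof
  fix n
  interpret gauss_tower p T K0bar by fact
  have d_theta: "d_theta p T K0bar r n = coset (dlog n (r n))" if "root_system p K0bar c r" for c r
    unfolding dlog_def by (rule d_theta_eq) (rule root_system_OB[OF that])
  obtain a where a: "lifts n a A" "\<And>i. a i \<in> OB"
    using lifts_exists_OB[OF assms(5), of n] by blast
  define w where "w = ghost_comp p a n"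
  have w: "w \<in> OB"
    unfolding w_def by (rule kaehler.ghost_comp_closed[OF a(2)])
  have theta_w: "absval (theta p A - w) \<le> (1 / real p) ^ n"
    unfolding w_def by (rule theta_approx[OF assms(5) a(1)])
  \<comment> \<open>The scalar through which \<open>theta p A\<close> acts on component
    \<open>n\<close> in \<open>tate_module\<close>; \<open>w\<close> shows that the choice is made
    from a nonempty set.\<close>
  define b where "b = (SOME b. b \<in> OB \<and> (\<exists>c\<in>carrier OK. theta p A - b = of_nat p ^ n * c))"
  have "b \<in> OB \<and> (\<exists>c\<in>carrier OK. theta p A - b = of_nat p ^ n * c)"
    unfolding b_def by (rule someI[of _ w]) (simp add: w theta_w p_power_dvd_iff)
  then have b: "b \<in> OB" "absval (theta p A - b) \<le> (1 / real p) ^ n"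
    unfolding p_power_dvd_iff by auto
  have w_b: "absval (w - b) \<le> (1 / real p) ^ n"
    using absval_diff_trans[of w b "theta p A"] absval_uminus[of "theta p A - w"] theta_w b(2) by simp
  have "kaehler.cong_N (dlog n (rT n) + dlog n (rU n)) (fscale w (dlog n (rp n)))"
    unfolding w_def using assms(2-6) a by (rule dlog_relation)
  also have "kaehler.cong_N \<dots> (fscale b (dlog n (rp n)))"
    by (rule dlog_scale_cong[OF assms(2) w b(1) w_b])
  finally have "coset (dlog n (rT n)) \<oplus>\<^bsub>Omega\<^esub> coset (dlog n (rU n)) = b \<odot>\<^bsub>Omega\<^esub> coset (dlog n (rp n))"
    by (simp add: Omega_add Omega_smult b(1) coset_eqI)
  then show "(d_theta p T K0bar rT \<oplus>\<^bsub>TT p T K0bar\<^esub> d_theta p T K0bar rU) n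
    = (theta p A \<odot>\<^bsub>TT p T K0bar\<^esub> d_theta p T K0bar rp) n"
    using assms(2-4) by (simp add: TT_def tate_module_def d_theta b_def flip: OA_def)
qed

end
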